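(* There exists a bounded domain $\Omega\subset\mathbb{C}^2$ biholomorphic to $\mathbb{D}\times\mathbb{D}$ for which the function $$z\mapsto\|\partial\log\mathsf{B}_\Omega(z,z)\|_{g_\Omega}$$ is unbounded on $\Omega$.
   Context: $\mathbb{D}\subset\mathbb{C}$ is the unit disk. $\mathsf{B}_\Omega$ is the Bergman kernel of $\Omega$ and $g_{\Omega,z}(v,w)=\sum_{i,j}\frac{\partial^2\log\mathsf{B}_\Omega(z,z)}{\partial z_i\partial\bar z_j}v_i\bar w_j$ is the Bergman metric. For a real-valued $\mathcal{C}^1$ function $\lambda$ put $\partial\lambda(X)=\sum_j\frac{\partial\lambda}{\partial z_j}X_j$; then at each point $z$, $\|\partial\lambda\|_{g_\Omega}=\max\{|\partial\lambda(X)|:X\in\mathbb{C}^2,\ g_{\Omega,z}(X,X)\le1\}$. Here it is applied to $\lambda(z)=\log\mathsf{B}_\Omega(z,z)$. *)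

theory Defs
  imports "HOL-Analysis.Analysis"
begin

text \<open>Points of \<open>\<complex>\<^sup>n\<close> are vectors of type \<^typ>\<open>complex^'n\<close>, with \<open>*s\<close> as complex scalar
  multiplication. Volume is Lebesgue measure on \<open>\<complex>\<^sup>n = \<real>\<^sup>2\<^sup>n\<close>, which is \<^term>\<open>lborel\<close>.\<close>

definition domain_Cn :: "(complex^'n) set \<Rightarrow> bool" where
  "domain_Cn \<Omega> \<longleftrightarrow> open \<Omega> \<and> connected \<Omega> \<and> \<Omega> \<noteq> {}"

definition holo_fun_on :: "(complex^'n) set \<Rightarrow> (complex^'n \<Rightarrow> complex) \<Rightarrow> bool" where
  "holo_fun_on \<Omega> f \<longleftrightarrow>
     (\<forall>z\<in>\<Omega>. \<exists>f'. (f has_derivative f') (at z) \<and> (\<forall>c v. f' (c *s v) = c * f' v))"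

definition holo_map_on :: "(complex^'n) set \<Rightarrow> (complex^'n \<Rightarrow> complex^'m) \<Rightarrow> bool" where
  "holo_map_on \<Omega> F \<longleftrightarrow> (\<forall>i. holo_fun_on \<Omega> (\<lambda>z. F z $ i))"

definition biholomorphic_Cn :: "(complex^'n) set \<Rightarrow> (complex^'m) set \<Rightarrow> bool" where
  "biholomorphic_Cn U V \<longleftrightarrow>
     (\<exists>F G. homeomorphism U V F G \<and> holo_map_on U F \<and> holo_map_on V G)"

definition bidisk :: "(complex^2) set" where
  "bidisk = {z. z $ 1 \<in> ball 0 1 \<and> z $ 2 \<in> ball 0 1}"

definition bergman_space :: "(complex^'n) set \<Rightarrow> (complex^'n \<Rightarrow> complex) set" where
  "bergman_space \<Omega> =
     {f. holo_fun_on \<Omega> f \<and> set_integrable lborel \<Omega> (\<lambda>z. (cmod (f z))\<^sup>2)}"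

text \<open>The Bergman kernel is the reproducing kernel of the Bergman space. The value \<open>0\<close> outside
  \<open>\<Omega> \<times> \<Omega>\<close> only serves to make it unique as a total function.\<close>

definition is_bergman_kernel ::
  "(complex^'n) set \<Rightarrow> (complex^'n \<Rightarrow> complex^'n \<Rightarrow> complex) \<Rightarrow> bool" where
  "is_bergman_kernel \<Omega> K \<longleftrightarrow>
     (\<forall>w\<in>\<Omega>. (\<lambda>z. K z w) \<in> bergman_space \<Omega> \<and>
        (\<forall>f\<in>bergman_space \<Omega>. f w = (LINT z:\<Omega>|lborel. f z * cnj (K z w)))) \<and>
     (\<forall>z w. z \<notin> \<Omega> \<or> w \<notin> \<Omega> \<longrightarrow> K z w = 0)"

definition bergman_kernel ::
  "(complex^'n) set \<Rightarrow> complex^'n \<Rightarrow> complex^'n \<Rightarrow> complex" where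
  "bergman_kernel \<Omega> = (THE K. is_bergman_kernel \<Omega> K)"

text \<open>On the diagonal the kernel is real and nonnegative (and positive if \<open>\<Omega>\<close> is bounded), so
  taking the real part loses nothing.\<close>

definition log_bergman :: "(complex^'n) set \<Rightarrow> complex^'n \<Rightarrow> real" where
  "log_bergman \<Omega> z = ln (Re (bergman_kernel \<Omega> z z))"

definition dir_deriv :: "complex^'n \<Rightarrow> (complex^'n \<Rightarrow> complex) \<Rightarrow> complex^'n \<Rightarrow> complex" where
  "dir_deriv v f z = vector_derivative (\<lambda>t::real. f (z + t *\<^sub>R v)) (at 0)"

text \<open>Wirtinger derivatives \<open>\<partial>/\<partial>z\<^sub>j\<close> and \<open>\<partial>/\<partial>z\<^sub>j\<close>-bar, where \<open>z\<^sub>j = x\<^sub>j + \<i> y\<^sub>j\<close>; the directions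
  of \<open>x\<^sub>j\<close> and \<open>y\<^sub>j\<close> are \<^term>\<open>axis j 1\<close> and \<^term>\<open>axis j \<i>\<close>.\<close>

definition dz :: "'n \<Rightarrow> (complex^'n \<Rightarrow> complex) \<Rightarrow> complex^'n \<Rightarrow> complex" where
  "dz j f z = (dir_deriv (axis j 1) f z - \<i> * dir_deriv (axis j \<i>) f z) / 2"

definition dzbar :: "'n \<Rightarrow> (complex^'n \<Rightarrow> complex) \<Rightarrow> complex^'n \<Rightarrow> complex" where
  "dzbar j f z = (dir_deriv (axis j 1) f z + \<i> * dir_deriv (axis j \<i>) f z) / 2"

definition bergman_metric ::
  "(complex^'n) set \<Rightarrow> complex^'n \<Rightarrow> complex^'n \<Rightarrow> complex^'n \<Rightarrow> complex" where
  "bergman_metric \<Omega> z v w =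
     (\<Sum>i\<in>UNIV. \<Sum>j\<in>UNIV.
        dz i (dzbar j (\<lambda>\<zeta>. complex_of_real (log_bergman \<Omega> \<zeta>))) z * v $ i * cnj (w $ j))"

definition del :: "(complex^'n \<Rightarrow> real) \<Rightarrow> complex^'n \<Rightarrow> complex^'n \<Rightarrow> complex" where
  "del u z X = (\<Sum>j\<in>UNIV. dz j (\<lambda>\<zeta>. complex_of_real (u \<zeta>)) z * X $ j)"

text \<open>\<open>g\<^sub>\<Omega>\<close> is a positive definite Hermitian form at each point of a bounded domain, so the form is
  real on the diagonal and the supremum is over a compact set, hence a maximum.\<close>

definition del_norm :: "(complex^'n) set \<Rightarrow> (complex^'n \<Rightarrow> real) \<Rightarrow> complex^'n \<Rightarrow> real" where
  "del_norm \<Omega> u z = (SUP X\<in>{X. Re (bergman_metric \<Omega> z X X) \<le> 1}. cmod (del u z X))"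

end

theory Submission
  imports Defs "HOL-Complex_Analysis.Cauchy_Integral_Formula"
begin

text \<open>Let \<open>E\<close> be a zero-free holomorphic function on the unit disk and let \<open>\<Omega>\<close> be the Hartogs domain
  \<open>{(z, w). \<bar>z\<bar> < 1 \<and> \<bar>w E(z)\<bar> < 1}\<close>. The map \<open>(z, w) \<mapsto> (z, w E(z))\<close> is a biholomorphism of \<open>\<Omega>\<close> onto
  the bidisk with Jacobian determinant \<open>E(z)\<close>. The Bergman metric is a biholomorphic invariant, but
  \<open>log B\<close> is not: passing from the bidisk to \<open>\<Omega>\<close> adds \<open>2 log \<bar>E(z)\<bar>\<close> to it, and hence the form
  \<open>E'(z)/E(z) dz\<close> to \<open>\<partial> log B\<close>. On the bidisk \<open>\<partial> log B\<close> has bounded length, and the length of \<open>dz\<close> is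
  comparable to \<open>1 - \<bar>z\<bar>\<^sup>2\<close>. So the norm in question is unbounded on \<open>\<Omega>\<close> as soon as
  \<open>(1 - \<bar>z\<bar>\<^sup>2) \<bar>E'(z)/E(z)\<bar>\<close> is unbounded on the disk. For \<open>E = exp \<circ> h\<close> this says that \<open>h\<close> is not a
  Bloch function. The function \<open>h(z) = 1/(1 - z)\<close> is not one: \<open>(1 - r\<^sup>2) h'(r) = (1 + r)/(1 - r)\<close>.
  Since \<open>Re h > 0\<close>, moreover \<open>\<bar>E\<bar> \<ge> 1\<close>, and \<open>\<Omega>\<close> is contained in the bidisk.

  The analytic work is to identify the kernel
  \<open>B((z, w), (a, b)) = E(z) cnj (E(a)) / (\<pi>\<^sup>2 (1 - z cnj a)\<^sup>2 (1 - w E(z) cnj (b E(a)))\<^sup>2)\<close>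
  (\<open>bergman_kernel_hartogs\<close>). The fibre of \<open>\<Omega>\<close> over \<open>z\<close> is the disk of radius \<open>1/\<bar>E(z)\<bar>\<close>, so by Fubini
  the reproducing property of this kernel reduces to that of the kernel of a disk, first in the
  fibres and then in the base. For a disk the reproducing formula is proved for every integrable
  holomorphic function (\<open>disc_reproducing\<close>), because integrability is what Fubini's theorem yields
  both in the fibres and in the base. It follows from the Taylor series and the orthogonality of the monomials, which in turn
  comes from the invariance of planar Lebesgue measure under rotations.

  Both the metric and \<open>\<partial> log B\<close> are then computed at the points \<open>(z, 0)\<close>, where the metric is diagonal.\<close>

section \<open>Lebesgue measure on \<open>\<complex>\<close> and \<open>\<complex>\<^sup>2\<close> as product measures\<close>

text \<open>Lebesgue measure is determined by the volumes of coordinate boxes, and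
  \<open>\<phi>\<close> only renames the coordinates of a point by \<open>\<sigma>\<close>. This
  is what makes Fubini's theorem available on \<open>\<complex>\<close> and on
  \<open>\<complex>\<^sup>2\<close>.\<close>

lemma lborel_distr_Basis_relabel:
  fixes \<phi> :: "'a::euclidean_space \<Rightarrow> 'b::euclidean_space"
  assumes bij: "bij_betw \<sigma> Basis Basis"
    and \<phi>: "\<And>x b. b \<in> Basis \<Longrightarrow> \<phi> x \<bullet> \<sigma> b = x \<bullet> b"
    and meas [measurable]: "\<phi> \<in> borel_measurable borel"
  shows "distr lborel borel \<phi> = lborel"
proof (rule lborel_eqI[symmetric])
  have im: "\<sigma> ` Basis = Basis"
    using bij by (simp add: bij_betw_def)
  fix l u :: 'b
  assume lu: "\<And>b. b \<in> Basis \<Longrightarrow> l \<bullet> b \<le> u \<bullet> b"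
  define l' u' :: 'a where "l' = (\<Sum>b\<in>Basis. (l \<bullet> \<sigma> b) *\<^sub>R b)" and "u' = (\<Sum>b\<in>Basis. (u \<bullet> \<sigma> b) *\<^sub>R b)"
  have l': "l' \<bullet> b = l \<bullet> \<sigma> b" and u': "u' \<bullet> b = u \<bullet> \<sigma> b" if "b \<in> Basis" for b
    using that by (simp_all add: l'_def u'_def)
  have "(\<forall>i\<in>Basis. l \<bullet> i < \<phi> x \<bullet> i \<and> \<phi> x \<bullet> i < u \<bullet> i) \<longleftrightarrow>
        (\<forall>b\<in>Basis. l' \<bullet> b < x \<bullet> b \<and> x \<bullet> b < u' \<bullet> b)" for x
    by (subst im[symmetric]) (simp add: \<phi> l' u')
  then have "\<phi> -` box l u = box l' u'"
    by (auto simp: box_def)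
  then have "emeasure (distr lborel borel \<phi>) (box l u) = emeasure lborel (box l' u')"
    by (simp add: emeasure_distr)
  also have "\<dots> = (\<Prod>b\<in>Basis. (u' - l') \<bullet> b)"
  proof (rule emeasure_lborel_box)
    fix b :: 'a assume b: "b \<in> Basis"
    then have "\<sigma> b \<in> Basis" using im by auto
    with b lu show "l' \<bullet> b \<le> u' \<bullet> b" by (simp add: l' u')
  qed
  also have "(\<Prod>b\<in>Basis. (u' - l') \<bullet> b) = (\<Prod>b\<in>Basis. (u - l) \<bullet> b)"
    by (subst prod.reindex_bij_betw[OF bij, symmetric]) (simp add: inner_diff_left l' u')
  finally show "emeasure (distr lborel borel \<phi>) (box l u) = ennreal (\<Prod>b\<in>Basis. (u - l) \<bullet> b)" .
qed simp

lemma lborel_complex_eq_distr: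
  "distr (lborel \<Otimes>\<^sub>M lborel) borel (\<lambda>(x, y). Complex x y) = lborel"
  unfolding lborel_prod
proof (rule lborel_distr_Basis_relabel)
  show "bij_betw (\<lambda>(x, y). Complex x y) Basis Basis"
    by (auto simp: bij_betw_def Basis_prod_def Basis_complex_def complex_eq_iff inj_on_def)
  show "(case x of (x, y) \<Rightarrow> Complex x y) \<bullet> (case b of (x, y) \<Rightarrow> Complex x y) = x \<bullet> b" for x b
    by (auto simp: inner_complex_def split: prod.splits)
  show "(\<lambda>(x, y). Complex x y) \<in> borel_measurable borel"
    by (intro borel_measurable_continuous_onI continuous_intros
        | simp add: case_prod_beta' Complex_eq)+
qed

definition pt :: "complex \<Rightarrow> complex \<Rightarrow> complex^2" where
  "pt z w = (\<chi> i. if i = 1 then z else w)"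

lemma pt_nth [simp]: "pt z w $ 1 = z" "pt z w $ 2 = w"
  by (simp_all add: pt_def)

lemma pt_eta: "pt (p $ 1) (p $ 2) = p"
  by (simp add: vec_eq_iff forall_2)

lemma continuous_on_pt [continuous_intros]:
  assumes "continuous_on S f" "continuous_on S g"
  shows "continuous_on S (\<lambda>x. pt (f x) (g x))"
  unfolding pt_def
proof (rule continuous_on_vec_lambda)
  show "continuous_on S (\<lambda>x. if i = 1 then f x else g x)" for i :: 2
    using assms by (cases "i = 1") simp_all
qed

lemma lborel_complex2_eq_distr:
  "distr (lborel \<Otimes>\<^sub>M lborel) borel (\<lambda>(z, w). pt z w) = lborel"
  unfolding lborel_prod
proof (rule lborel_distr_Basis_relabel)
  have [simp]: "pt u 0 = axis 1 u" "pt 0 u = axis 2 u" for u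
    by (simp_all add: vec_eq_iff forall_2 axis_def)
  have U: "(UNIV :: 2 set) = {1, 2}" using UNIV_2 by simp
  show "bij_betw (\<lambda>(z, w). pt z w) Basis Basis"
    unfolding bij_betw_def
  proof
    show "inj_on (\<lambda>(z, w). pt z w) Basis"
      by (auto simp: inj_on_def) (metis pt_nth)+
    show "(\<lambda>(z, w). pt z w) ` Basis = Basis"
      by (auto simp: Basis_prod_def Basis_vec_def U image_Un image_image)
  qed
  show "(case x of (z, w) \<Rightarrow> pt z w) \<bullet> (case b of (z, w) \<Rightarrow> pt z w) = x \<bullet> b" for x b
    by (auto simp: inner_vec_def U split: prod.splits)
  show "(\<lambda>(z, w). pt z w) \<in> borel_measurable borel"
    by (intro borel_measurable_continuous_onI continuous_intros
        | simp add: case_prod_beta')+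
qed

lemma measurable_pt [measurable]:
  "(\<lambda>(z, w). pt z w) \<in> borel_measurable (borel \<Otimes>\<^sub>M borel)"
  unfolding borel_prod
  by (intro borel_measurable_continuous_onI continuous_intros
        | simp add: case_prod_beta')+

lemma measurable_Complex [measurable]:
  "(\<lambda>(x, y). Complex x y) \<in> borel_measurable (borel \<Otimes>\<^sub>M borel)"
  unfolding borel_prod
  by (intro borel_measurable_continuous_onI continuous_intros
        | simp add: case_prod_beta' Complex_eq)+

lemma nn_integral_complex_iterated:
  assumes [measurable]: "f \<in> borel_measurable borel"
  shows "(\<integral>\<^sup>+z. f z \<partial>lborel) = (\<integral>\<^sup>+y. \<integral>\<^sup>+x. f (Complex x y) \<partial>lborel \<partial>lborel)"
    "(\<integral>\<^sup>+z. f z \<partial>lborel) = (\<integral>\<^sup>+x. \<integral>\<^sup>+y. f (Complex x y) \<partial>lborel \<partial>lborel)"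
proof -
  have "(\<integral>\<^sup>+z. f z \<partial>lborel) = (\<integral>\<^sup>+p. f (case p of (x, y) \<Rightarrow> Complex x y) \<partial>(lborel \<Otimes>\<^sub>M lborel))"
    by (subst lborel_complex_eq_distr[symmetric], subst nn_integral_distr) simp_all
  moreover have "\<dots> = (\<integral>\<^sup>+x. \<integral>\<^sup>+y. f (Complex x y) \<partial>lborel \<partial>lborel)"
    by (subst lborel.nn_integral_fst[symmetric]) simp_all
  moreover have "\<dots> = (\<integral>\<^sup>+y. \<integral>\<^sup>+x. f (Complex x y) \<partial>lborel \<partial>lborel)"
    by (rule lborel_pair.Fubini') simp
  ultimately show "(\<integral>\<^sup>+z. f z \<partial>lborel) = (\<integral>\<^sup>+y. \<integral>\<^sup>+x. f (Complex x y) \<partial>lborel \<partial>lborel)"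
    "(\<integral>\<^sup>+z. f z \<partial>lborel) = (\<integral>\<^sup>+x. \<integral>\<^sup>+y. f (Complex x y) \<partial>lborel \<partial>lborel)"
    by simp_all
qed

section \<open>Rotations of the plane\<close>

text \<open>With \<open>c = a + \<i> b\<close> and \<open>a \<noteq> 0\<close>, the rotation is
  a composition of two one-dimensional affine substitutions, \<open>x \<mapsto> a x - b
  y\<close> for fixed \<open>y\<close> and then \<open>y \<mapsto> (y + b x) / a\<close> for
  fixed \<open>x\<close>. Their factors \<open>\<bar>a\<bar>\<close> and \<open>1 /
  \<bar>a\<bar>\<close> cancel.\<close>

lemma nn_integral_complex_rotate:
  assumes [measurable]: "f \<in> borel_measurable borel" and c: "cmod c = 1" "Re c \<noteq> 0"
  shows "(\<integral>\<^sup>+z. f (c * z) \<partial>lborel) = (\<integral>\<^sup>+z. f z \<partial>lborel)"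
proof -
  define a b where "a = Re c" and "b = Im c"
  have a: "a \<noteq> 0" and ab: "a^2 + b^2 = 1"
    using c by (auto simp: a_def b_def cmod_def)
  have mul: "c * Complex x y = Complex (a * x - b * y) (b * x + a * y)" for x y
    by (simp add: a_def b_def complex_eq_iff)
  have [measurable]: "(\<lambda>p. f (Complex (g p) (h p))) \<in> borel_measurable M"
    if [measurable]: "g \<in> borel_measurable M" "h \<in> borel_measurable M" for g h and M :: "'z measure"
  proof -
    have "(\<lambda>p. f (case (g p, h p) of (x, y) \<Rightarrow> Complex x y)) \<in> borel_measurable M"
      by measurable
    then show ?thesis by simp
  qed
  have "(\<integral>\<^sup>+z. f (c * z) \<partial>lborel)
        = (\<integral>\<^sup>+y. \<integral>\<^sup>+x. f (Complex (a * x - b * y) (b * x + a * y)) \<partial>lborel \<partial>lborel)"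
    by (subst nn_integral_complex_iterated(1)) (simp_all add: mul)
  also have "\<dots> = (\<integral>\<^sup>+y. \<bar>1/a\<bar> * (\<integral>\<^sup>+x. f (Complex x (y / a + b / a * x)) \<partial>lborel) \<partial>lborel)"
  proof (rule nn_integral_cong)
    fix y :: real
    have eq: "b * (b * y / a + x / a) + a * y = y / a + b / a * x"
     "a * (b * y / a + x / a) - b * y = x" for x
    proof -
      have "b * (b * y / a + x / a) + a * y = (a^2 + b^2) * y / a + b / a * x"
        using a by (simp add: field_simps power2_eq_square)
      then show "b * (b * y / a + x / a) + a * y = y / a + b / a * x"
        using ab by simp
    qed (use a in \<open>simp add: field_simps\<close>)
    show "(\<integral>\<^sup>+x. f (Complex (a * x - b * y) (b * x + a * y)) \<partial>lborel) =
        \<bar>1/a\<bar> * (\<integral>\<^sup>+x. f (Complex x (y / a + b / a * x)) \<partial>lborel)"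
      using a by (subst nn_integral_real_affine[where c="1/a" and t="b*y/a"]) (simp_all add: eq)
  qed
  also have "\<dots> = \<bar>1/a\<bar> * (\<integral>\<^sup>+x. \<integral>\<^sup>+y. f (Complex x (y / a + b / a * x)) \<partial>lborel \<partial>lborel)"
    by (subst nn_integral_cmult, measurable) (subst lborel_pair.Fubini', measurable)
  also have "(\<integral>\<^sup>+x. \<integral>\<^sup>+y. f (Complex x (y / a + b / a * x)) \<partial>lborel \<partial>lborel)
     = (\<integral>\<^sup>+x. \<bar>a\<bar> * (\<integral>\<^sup>+y. f (Complex x y) \<partial>lborel) \<partial>lborel)"
  proof (rule nn_integral_cong)
    fix x :: real
    show "(\<integral>\<^sup>+y. f (Complex x (y / a + b / a * x)) \<partial>lborel)
        = \<bar>a\<bar> * (\<integral>\<^sup>+y. f (Complex x y) \<partial>lborel)"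
      using a by (subst nn_integral_real_affine[where c="a" and t="- b * x"]) (simp_all add: field_simps)
  qed
  also have "\<dots> = \<bar>a\<bar> * (\<integral>\<^sup>+z. f z \<partial>lborel)"
    by (subst nn_integral_cmult) (simp_all add: nn_integral_complex_iterated(2))
  also have "\<bar>1/a\<bar> * (\<bar>a\<bar> * (\<integral>\<^sup>+z. f z \<partial>lborel)) = (\<integral>\<^sup>+z. f z \<partial>lborel)"
    using a by (simp add: mult.assoc[symmetric] ennreal_mult[symmetric])
  finally show ?thesis .
qed

lemma lborel_distr_complex_rotate:
  assumes "cmod c = 1" "Re c \<noteq> 0"
  shows "distr lborel borel (\<lambda>z. c * z) = lborel"
proof (rule measure_eqI)
  fix A :: "complex set" assume "A \<in> sets (distr lborel borel (\<lambda>z. c * z))"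
  then have [measurable]: "A \<in> sets borel" by simp
  have "emeasure (distr lborel borel (\<lambda>z. c * z)) A = (\<integral>\<^sup>+z. indicator A z \<partial>distr lborel borel (\<lambda>z. c * z))"
    by simp
  also have "\<dots> = (\<integral>\<^sup>+z. indicator A (c * z) \<partial>lborel)"
    by (rule nn_integral_distr) simp_all
  also have "\<dots> = emeasure lborel A"
    using nn_integral_complex_rotate[of "indicator A" c] assms by simp
  finally show "emeasure (distr lborel borel (\<lambda>z. c * z)) A = emeasure lborel A" .
qed simp

section \<open>Set integrals\<close>

text \<open>Term-by-term integration under a summable majorant; on a set of finite measure the
  constants \<open>B m\<close> are integrable.\<close>

lemma set_integral_sums:
  fixes f :: "nat \<Rightarrow> 'a \<Rightarrow> 'b::{banach, second_countable_topology}"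
  assumes A [measurable]: "A \<in> sets M" and fin: "emeasure M A < \<infinity>"
    and meas: "\<And>m. set_borel_measurable M A (f m)"
    and bound: "\<And>m x. x \<in> A \<Longrightarrow> norm (f m x) \<le> B m" and B: "summable B"
  shows "(\<lambda>m. LINT x:A|M. f m x) sums (LINT x:A|M. (\<Sum>m. f m x))"
proof -
  define F where "F m x = indicator A x *\<^sub>R f m x" for m x
  have [measurable]: "F m \<in> borel_measurable M" for m
    using meas[of m] by (simp add: F_def[abs_def] set_borel_measurable_def)
  have intA: "integrable M (\<lambda>x. indicator A x * B m)" for m
    using fin by simp
  have Fle: "norm (F m x) \<le> indicator A x * B m" for m x
    using bound[of x m] by (simp add: F_def indicator_def)
  have B0: "B m \<ge> 0" if "x \<in> A" for x m
    using bound[OF that, of m] norm_ge_zero[of "f m x"] by linarith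
  have F: "integrable M (F m)" for m
    by (rule Bochner_Integration.integrable_bound[OF intA[of m]])
      (use B0 Fle[of m] in \<open>auto intro!: AE_I2 simp: F_def indicator_def split: if_splits\<close>)
  have summ: "summable (\<lambda>m. norm (F m x))" for x
  proof (rule summable_comparison_test'[OF summable_mult[OF B, of "indicator A x"]])
    show "norm (norm (F m x)) \<le> indicator A x * B m" for m
      using Fle by simp
  qed
  have "summable (\<lambda>m. \<integral>x. norm (F m x) \<partial>M)"
  proof (rule summable_comparison_test'[OF summable_mult[OF B, of "measure M A"]])
    fix m
    have "(\<integral>x. norm (F m x) \<partial>M) \<le> (\<integral>x. indicator A x * B m \<partial>M)"
      by (intro integral_mono F intA integrable_norm Fle)
    then show "norm (\<integral>x. norm (F m x) \<partial>M) \<le> measure M A * B m"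
      by (simp add: integral_nonneg_AE sets.Int_space_eq2[OF A])
  qed
  then have "(\<lambda>m. integral\<^sup>L M (F m)) sums (\<integral>x. (\<Sum>m. F m x) \<partial>M)"
    by (intro sums_integral F AE_I2 summ)
  moreover have "(\<Sum>m. F m x) = indicator A x *\<^sub>R (\<Sum>m. f m x)" for x
    by (simp add: F_def indicator_def)
  ultimately show ?thesis
    by (simp add: F_def[abs_def] set_lebesgue_integral_def)
qed

lemma set_borel_measurable_continuous_on:
  fixes f :: "'a::euclidean_space \<Rightarrow> 'b::real_normed_vector"
  assumes "continuous_on A f" "A \<in> sets borel"
  shows "set_borel_measurable lborel A f"
  using borel_measurable_continuous_on_indicator[OF assms(2,1)]
  by (simp add: set_borel_measurable_def)

lemma set_integrable_bounded_mult:
  fixes f g :: "'a::euclidean_space \<Rightarrow> complex"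
  assumes f: "set_integrable lborel A f" and A: "A \<in> sets borel"
    and g: "continuous_on A g" "\<And>x. x \<in> A \<Longrightarrow> cmod (g x) \<le> C"
  shows "set_integrable lborel A (\<lambda>x. f x * g x)"
proof -
  have 1: "integrable lborel (\<lambda>x. indicator A x *\<^sub>R f x)"
    using f by (simp add: set_integrable_def)
  have [measurable]: "(\<lambda>x. indicator A x *\<^sub>R g x) \<in> borel_measurable lborel"
    using set_borel_measurable_continuous_on[OF g(1) A] by (simp add: set_borel_measurable_def)
  have [measurable]: "(\<lambda>x. indicator A x *\<^sub>R f x) \<in> borel_measurable lborel"
    using borel_measurable_integrable[OF 1] .
  have eq: "indicator A x *\<^sub>R (f x * g x) = (indicator A x *\<^sub>R f x) * (indicator A x *\<^sub>R g x)" for x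
    by (simp add: indicator_def)
  have "integrable lborel (\<lambda>x. (indicator A x *\<^sub>R f x) * (indicator A x *\<^sub>R g x))"
  proof (rule Bochner_Integration.integrable_bound)
    show "integrable lborel (\<lambda>x. complex_of_real C * (indicator A x *\<^sub>R f x))"
      using 1 by (rule integrable_mult_right)
    show "AE x in lborel. norm ((indicator A x *\<^sub>R f x) * (indicator A x *\<^sub>R g x))
            \<le> norm (complex_of_real C * (indicator A x *\<^sub>R f x))"
    proof (rule AE_I2)
      fix x
      have "cmod (f x) * cmod (g x) \<le> \<bar>C\<bar> * cmod (f x)" if "x \<in> A"
        using mult_left_mono[OF order_trans[OF g(2)[OF that] abs_ge_self[of C]], of "cmod (f x)"]
        by (simp add: mult.commute)
      then show "norm ((indicator A x *\<^sub>R f x) * (indicator A x *\<^sub>R g x))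
            \<le> norm (complex_of_real C * (indicator A x *\<^sub>R f x))"
        by (auto simp: indicator_def norm_mult)
    qed
  qed measurable
  then show ?thesis
    by (simp only: set_integrable_def eq)
qed

section \<open>Moments of the disk and its reproducing kernel\<close>

text \<open>A rotation by \<open>c\<close> preserves the integral and multiplies the integrand
  by \<open>c\<^sup>m cnj (c)\<^sup>n\<close>, so the integral vanishes if this factor differs
  from \<open>1\<close>.\<close>

lemma moment_disc_neq:
  assumes "m \<noteq> n"
  shows "(LINT z:ball 0 r|lborel. z ^ m * cnj z ^ n) = 0"
proof -
  (* The angle is chosen so that c^m * cnj c^n = cis (pi/3) or cis (-pi/3), while Re c > 0. *)
  define k :: real where "k = real m - real n"
  define t where "t = pi / (3 * \<bar>k\<bar>)"
  have k: "\<bar>k\<bar> \<ge> 1"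
    using assms by (simp add: k_def)
  then have t: "0 < t" "t \<le> pi / 3"
    by (auto simp: t_def field_simps)
  have cos: "cos t > 0"
    using t by (intro cos_gt_zero) (auto simp: field_simps)
  define F where "F z = indicator (ball 0 r) z *\<^sub>R (z ^ m * cnj z ^ n)" for z :: complex
  have [measurable]: "F \<in> borel_measurable borel"
    unfolding F_def by (intro borel_measurable_continuous_on_indicator continuous_intros) simp
  define c where "c = cis t"
  have eq: "F (c * z) = c ^ m * cnj c ^ n * F z" for z
    by (simp add: F_def indicator_def c_def norm_mult power_mult_distrib)
  have "integral\<^sup>L lborel F = integral\<^sup>L (distr lborel borel (\<lambda>z. c * z)) F"
    using lborel_distr_complex_rotate[of c] cos by (simp add: c_def)
  also have "\<dots> = (\<integral>z. F (c * z) \<partial>lborel)"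
    by (rule integral_distr) simp_all
  also have "\<dots> = c ^ m * cnj c ^ n * integral\<^sup>L lborel F"
    by (simp add: eq)
  finally have "integral\<^sup>L lborel F * (c ^ m * cnj c ^ n - 1) = 0"
    by (simp add: algebra_simps)
  moreover have "c ^ m * cnj c ^ n \<noteq> 1"
  proof -
    have "c ^ m * cnj c ^ n = cis (real m * t + real n * (- t))"
      by (simp only: c_def cis_cnj Complex.DeMoivre cis_mult)
    then have "c ^ m * cnj c ^ n = cis (k * t)"
      by (simp only: k_def left_diff_distrib mult_minus_right add_uminus_conv_diff)
    moreover have "k * t = pi / 3 \<or> k * t = - (pi / 3)"
      using k by (cases "k \<ge> 0") (auto simp: t_def)
    moreover from this have "cos (k * t) = cos (pi / 3)"
      by (metis cos_minus)
    ultimately have "Re (c ^ m * cnj c ^ n) = 1 / 2"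
      by (simp add: cos_60)
    then have "Re (c ^ m * cnj c ^ n) \<noteq> Re 1"
      by (simp del: times_complex.sel)
    then show ?thesis
      by metis
  qed
  ultimately show ?thesis
    by (simp add: set_lebesgue_integral_def F_def[abs_def])
qed

lemma measure_disc: "r \<ge> 0 \<Longrightarrow> measure lborel (ball (0::complex) r) = pi * r\<^sup>2"
  by (simp add: content_ball unit_ball_vol_2)

lemma emeasure_disc_finite: "emeasure lborel (ball (0::complex) r) < \<infinity>"
  by (rule emeasure_lborel_ball_finite)

lemma radial_moment_scale:
  assumes r: "r > 0"
  shows "(LINT z:ball 0 r|lborel. cmod z ^ (2 * n)) = r ^ (2 * n + 2) * (LINT z:ball 0 1|lborel. cmod z ^ (2 * n))"
proof -
  define F where "F z = indicator (ball 0 r) z *\<^sub>R (cmod z ^ (2 * n))" for z :: complex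
  have [measurable]: "F \<in> borel_measurable borel"
    unfolding F_def by (intro borel_measurable_continuous_on_indicator continuous_intros) simp
  have eq: "F (r *\<^sub>R z) = r ^ (2 * n) * (indicator (ball 0 1) z *\<^sub>R (cmod z ^ (2 * n)))" for z
    using r by (simp add: F_def indicator_def power_mult_distrib)
  have "integral\<^sup>L lborel F = integral\<^sup>L (density (distr lborel borel (\<lambda>z. 0 + r *\<^sub>R z)) (\<lambda>_. \<bar>r\<bar> ^ DIM(complex))) F"
    using r by (subst lborel_affine[of r 0]) simp_all
  also have "\<dots> = \<bar>r\<bar> ^ 2 * (\<integral>z. F (r *\<^sub>R z) \<partial>lborel)"
    by (simp add: integral_density integral_distr)
  also have "\<dots> = r ^ (2 * n + 2) * (LINT z:ball 0 1|lborel. cmod z ^ (2 * n))"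
    by (simp only: eq) (simp add: set_lebesgue_integral_def power_add power2_eq_square)
  finally show ?thesis
    by (simp only: set_lebesgue_integral_def F_def[abs_def])
qed

text \<open>Let \<open>J\<close> be the integral. By scaling, the annulus \<open>s \<le>
  \<bar>z\<bar> < 1\<close> contributes \<open>(1 - s\<^sup>2\<^sup>n\<^sup>+\<^sup>2)
  J\<close>. On the annulus the integrand lies between \<open>s\<^sup>2\<^sup>n\<close> and
  \<open>1\<close>, and the area is \<open>\<pi> (1 - s\<^sup>2)\<close>. Dividing by \<open>1 -
  s\<^sup>2\<close> and letting \<open>s\<close> tend to \<open>1\<close> gives \<open>(n + 1) J
  = \<pi>\<close>.\<close>

lemma radial_moment_unit:
  "(LINT z:ball 0 1|lborel. cmod z ^ (2 * n)) = pi / (real n + 1)"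
proof -
  define J where "J r = (LINT z:ball 0 r|lborel. cmod z ^ (2 * n))" for r
  have int: "set_integrable lborel (ball 0 r) (\<lambda>z::complex. cmod z ^ (2 * n))" for r
  proof (rule set_integrable_subset)
    show "set_integrable lborel (cball 0 r) (\<lambda>z::complex. cmod z ^ (2 * n))"
      unfolding set_integrable_def by (rule borel_integrable_compact) (auto intro!: continuous_intros)
  qed auto
  have bounds: "s ^ (2 * n) * pi \<le> J 1 * (\<Sum>k<Suc n. (s\<^sup>2) ^ k) \<and> J 1 * (\<Sum>k<Suc n. (s\<^sup>2) ^ k) \<le> pi"
    if s: "0 < s" "s < 1" for s
  proof -
    (* The quotient (1 - s^(2n+2)) / (1 - s^2) is written as a geometric sum to pass to the limit. *)
    define S where "S = ball 0 1 - ball (0::complex) s"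
    have [measurable]: "S \<in> sets borel" by (simp add: S_def)
    have fin: "emeasure lborel S < \<infinity>"
      using emeasure_mono[of S "ball 0 1" lborel] emeasure_disc_finite[of 1]
      by (auto simp: S_def intro: le_less_trans)
    have iS: "set_integrable lborel S (\<lambda>z::complex. cmod z ^ (2 * n))"
      by (rule set_integrable_subset[OF int[of 1]]) (auto simp: S_def)
    have ic: "set_integrable lborel S (\<lambda>z::complex. a)" for a :: real
      using fin by (simp add: set_integrable_def)
    have un: "ball 0 1 = ball (0::complex) s \<union> S"
      using s by (auto simp: S_def)
    have "J 1 = J s + (LINT z:S|lborel. cmod z ^ (2 * n))"
      unfolding J_def by (subst un, rule set_integral_Un) (auto simp: S_def int iS[unfolded S_def])
    moreover have "J s = (s\<^sup>2) ^ Suc n * J 1"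
      using radial_moment_scale[of s n] s
      by (simp only: J_def power_mult[symmetric] mult_Suc_right add.commute)
    ultimately have "(LINT z:S|lborel. cmod z ^ (2 * n)) = J 1 * (1 - (s\<^sup>2) ^ Suc n)"
      by (simp only: right_diff_distrib mult.commute mult_1_right)
    also have "\<dots> = (1 - s\<^sup>2) * (J 1 * (\<Sum>k<Suc n. (s\<^sup>2) ^ k))"
      by (simp only: one_diff_power_eq mult_ac)
    finally have S: "(LINT z:S|lborel. cmod z ^ (2 * n)) = (1 - s\<^sup>2) * (J 1 * (\<Sum>k<Suc n. (s\<^sup>2) ^ k))" .
    have "measure lborel S = pi * (1 - s\<^sup>2)"
      unfolding S_def using s emeasure_disc_finite[of 1]
      by (subst measure_Diff) (auto simp: measure_disc algebra_simps top.not_eq_extremum)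
    then have mS: "(LINT z:S|lborel. a) = (1 - s\<^sup>2) * (a * pi)" for a :: real
      by (simp add: set_lebesgue_integral_def mult_ac)
    have pos: "1 - s\<^sup>2 > 0" using s by (simp add: power_less_one_iff)
    have "(LINT z:S|lborel. s ^ (2 * n)) \<le> (LINT z:S|lborel. cmod z ^ (2 * n))"
      using s by (intro set_integral_mono ic iS power_mono) (auto simp: S_def)
    then have 1: "s ^ (2 * n) * pi \<le> J 1 * (\<Sum>k<Suc n. (s\<^sup>2) ^ k)"
      unfolding S mS using pos by (simp only: mult_le_cancel_left_pos)
    have "(LINT z:S|lborel. cmod z ^ (2 * n)) \<le> (LINT z:S|lborel. 1)"
      by (intro set_integral_mono ic iS power_le_one) (auto simp: S_def)
    then have 2: "J 1 * (\<Sum>k<Suc n. (s\<^sup>2) ^ k) \<le> pi"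
      unfolding S mS using pos by (simp only: mult_le_cancel_left_pos mult_1)
    show ?thesis using 1 2 by blast
  qed
  have lim: "((\<lambda>s. J 1 * (\<Sum>k<Suc n. (s\<^sup>2) ^ k)) \<longlongrightarrow> J 1 * (\<Sum>k<Suc n. (1\<^sup>2) ^ k)) (at_left 1)"
    by (intro tendsto_intros)
  have lim': "((\<lambda>s. J 1 * (\<Sum>k<Suc n. (s\<^sup>2) ^ k)) \<longlongrightarrow> pi) (at_left 1)"
  proof (rule tendsto_sandwich)
    have ev: "eventually (\<lambda>s::real. 0 < s \<and> s < 1) (at_left 1)"
      using eventually_at_left_real[of 0 1] by simp
    show "eventually (\<lambda>s. s ^ (2 * n) * pi \<le> J 1 * (\<Sum>k<Suc n. (s\<^sup>2) ^ k)) (at_left 1)"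
      "eventually (\<lambda>s. J 1 * (\<Sum>k<Suc n. (s\<^sup>2) ^ k) \<le> pi) (at_left 1)"
      using ev by (eventually_elim, use bounds in blast)+
    have "((\<lambda>s::real. s ^ (2 * n) * pi) \<longlongrightarrow> 1 ^ (2 * n) * pi) (at_left 1)"
      by (intro tendsto_intros)
    then show "((\<lambda>s::real. s ^ (2 * n) * pi) \<longlongrightarrow> pi) (at_left 1)" by simp
  qed simp
  have "J 1 * (\<Sum>k<Suc n. (1\<^sup>2) ^ k) = pi"
    by (rule tendsto_unique[OF _ lim lim']) simp
  then show ?thesis
    by (simp add: J_def field_simps)
qed

lemma moment_disc_eq:
  assumes "r > 0"
  shows "(LINT z:ball 0 r|lborel. z ^ n * cnj z ^ n) = of_real (pi * r ^ (2 * n + 2) / (real n + 1))"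
proof -
  have "z ^ n * cnj z ^ n = of_real (cmod z ^ (2 * n))" for z
    by (simp add: power_mult_distrib[symmetric] complex_norm_square[symmetric] power_mult)
  then have "(LINT z:ball 0 r|lborel. z ^ n * cnj z ^ n) = (LINT z:ball 0 r|lborel. of_real (cmod z ^ (2 * n)))"
    by simp
  also have "\<dots> = of_real (LINT z:ball 0 r|lborel. cmod z ^ (2 * n))"
    by (rule set_integral_complex_of_real)
  finally show ?thesis
    using assms by (simp add: radial_moment_scale radial_moment_unit)
qed

text \<open>Of the Taylor series of \<open>g\<close>, which converges uniformly on the smaller
  disk, only the term of degree \<open>n\<close> is not orthogonal to
  \<open>z\<^sup>n\<close>.\<close>

lemma taylor_coefficient_disc_integral:
  assumes g: "g holomorphic_on ball 0 R" and r: "0 < r" "r < R"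
  shows "(LINT z:ball 0 r|lborel. g z * cnj z ^ n) =
           of_real (pi * r ^ (2 * n + 2) / (real n + 1)) * ((deriv ^^ n) g 0 / fact n)"
proof -
  define a where "a m = (deriv ^^ m) g 0 / fact m" for m
  have sums: "(\<lambda>m. a m * z ^ m) sums g z" if "z \<in> ball 0 R" for z
    using holomorphic_power_series[OF g that] by (simp add: a_def)
  (* Convergence at a radius larger than r gives absolute convergence at r. *)
  obtain r' where r': "r < r'" "r' < R" using r dense by blast
  have "summable (\<lambda>m. a m * of_real r' ^ m)"
    using sums[of "of_real r'"] r r' by (auto simp: sums_iff)
  then have "summable (\<lambda>m. norm (a m * of_real r ^ m))"
    by (rule powser_insidea) (use r r' in auto)
  then have B: "summable (\<lambda>m. cmod (a m) * r ^ m * r ^ n)"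
    using r by (intro summable_mult2) (simp add: norm_mult norm_power)
  have "(\<lambda>m. LINT z:ball 0 r|lborel. a m * z ^ m * cnj z ^ n) sums
        (LINT z:ball 0 r|lborel. (\<Sum>m. a m * z ^ m * cnj z ^ n))"
  proof (rule set_integral_sums[OF _ _ _ _ B])
    show "set_borel_measurable lborel (ball 0 r) (\<lambda>z. a m * z ^ m * cnj z ^ n)" for m
      by (intro set_borel_measurable_continuous_on continuous_intros) simp
    show "cmod (a m * z ^ m * cnj z ^ n) \<le> cmod (a m) * r ^ m * r ^ n" if "z \<in> ball 0 r" for m z
      using that r by (auto simp: norm_mult norm_power intro!: mult_mono power_mono mult_nonneg_nonneg)
  qed (use emeasure_disc_finite in auto)
  also have "(\<lambda>m. LINT z:ball 0 r|lborel. a m * z ^ m * cnj z ^ n) =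
      (\<lambda>m. if m = n then a n * of_real (pi * r ^ (2 * n + 2) / (real n + 1)) else 0)"
    using moment_disc_neq moment_disc_eq[OF r(1)] by (auto simp: mult.assoc fun_eq_iff)
  also have "(LINT z:ball 0 r|lborel. (\<Sum>m. a m * z ^ m * cnj z ^ n)) = (LINT z:ball 0 r|lborel. g z * cnj z ^ n)"
  proof (rule set_lebesgue_integral_cong)
    show "\<forall>z. z \<in> ball 0 r \<longrightarrow> (\<Sum>m. a m * z ^ m * cnj z ^ n) = g z * cnj z ^ n"
    proof (intro allI impI)
      fix z :: complex assume "z \<in> ball 0 r"
      then have "z \<in> ball 0 R" using r by auto
      then show "(\<Sum>m. a m * z ^ m * cnj z ^ n) = g z * cnj z ^ n"
        using sums_mult2[OF sums] by (auto simp: sums_iff)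
    qed
  qed simp
  finally have "(\<lambda>m. if m = n then a n * of_real (pi * r ^ (2 * n + 2) / (real n + 1)) else 0)
     sums (LINT z:ball 0 r|lborel. g z * cnj z ^ n)" .
  moreover have "(\<lambda>m. if m = n then a n * of_real (pi * r ^ (2 * n + 2) / (real n + 1)) else 0)
     sums (a n * of_real (pi * r ^ (2 * n + 2) / (real n + 1)))"
    by (rule sums_single)
  ultimately have "(LINT z:ball 0 r|lborel. g z * cnj z ^ n) = a n * of_real (pi * r ^ (2 * n + 2) / (real n + 1))"
    by (rule sums_unique2)
  then show ?thesis
    by (simp only: a_def mult.commute)
qed

text \<open>Expand \<open>1/(1 - x)\<^sup>2 = \<Sum>n. (n + 1) x\<^sup>n\<close> with \<open>x =
  cnj z c\<close> and integrate term by term. The factor \<open>n + 1\<close> cancels the one in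
  the moments, which leaves the Taylor series of \<open>g\<close> at \<open>r\<^sup>2
  c\<close>.\<close>

lemma disc_reproducing_inner:
  assumes g: "g holomorphic_on ball 0 R" and r: "0 < r" "r < R" and c: "cmod c * r < 1"
  shows "(LINT z:ball 0 r|lborel. g z / (1 - cnj z * c)\<^sup>2) = of_real (pi * r\<^sup>2) * g (of_real (r\<^sup>2) * c)"
proof -
  define a where "a m = (deriv ^^ m) g 0 / fact m" for m
  have "continuous_on (cball 0 r) g"
    using g r by (intro holomorphic_on_imp_continuous_on[OF holomorphic_on_subset]) auto
  then have "bounded (g ` cball 0 r)"
    by (intro compact_imp_bounded compact_continuous_image) auto
  then obtain C where C: "\<And>z. z \<in> cball 0 r \<Longrightarrow> cmod (g z) \<le> C"
    unfolding bounded_iff by blast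
  have C0: "C \<ge> 0" using C[of 0] r norm_ge_zero[of "g 0"] by (simp del: norm_ge_zero)
  have "summable (\<lambda>n. of_nat (Suc n) * (cmod c * r) ^ n)"
    using geometric_deriv_sums[of "cmod c * r"] c r by (auto simp: sums_iff)
  then have B: "summable (\<lambda>n. C * (of_nat (Suc n) * (cmod c * r) ^ n))"
    by (rule summable_mult)
  have "(\<lambda>n. LINT z:ball 0 r|lborel. g z * (of_nat (Suc n) * (cnj z * c) ^ n)) sums
        (LINT z:ball 0 r|lborel. (\<Sum>n. g z * (of_nat (Suc n) * (cnj z * c) ^ n)))"
  proof (rule set_integral_sums[OF _ _ _ _ B])
    show "set_borel_measurable lborel (ball 0 r) (\<lambda>z. g z * (of_nat (Suc n) * (cnj z * c) ^ n))" for n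
      using g r
      by (intro set_borel_measurable_continuous_on continuous_intros
           holomorphic_on_imp_continuous_on[OF holomorphic_on_subset]) auto
    show "cmod (g z * (of_nat (Suc n) * (cnj z * c) ^ n)) \<le> C * (of_nat (Suc n) * (cmod c * r) ^ n)"
      if "z \<in> ball 0 r" for n z
    proof -
      have "cmod (cnj z * c) ^ n \<le> (cmod c * r) ^ n"
        using that mult_right_mono[of "cmod z" r "cmod c"]
        by (intro power_mono) (simp_all add: norm_mult mult.commute)
      moreover have "cmod (g z) \<le> C" using that C by simp
      ultimately show ?thesis
        unfolding norm_mult norm_power norm_of_nat using C0 by (intro mult_mono) auto
    qed
  qed (use emeasure_disc_finite in auto)
  also have "(LINT z:ball 0 r|lborel. (\<Sum>n. g z * (of_nat (Suc n) * (cnj z * c) ^ n)))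
     = (LINT z:ball 0 r|lborel. g z / (1 - cnj z * c)\<^sup>2)"
  proof (rule set_lebesgue_integral_cong)
    show "\<forall>z. z \<in> ball 0 r \<longrightarrow> (\<Sum>n. g z * (of_nat (Suc n) * (cnj z * c) ^ n)) = g z / (1 - cnj z * c)\<^sup>2"
    proof (intro allI impI)
      fix z :: complex assume z: "z \<in> ball 0 r"
      have "cmod (cnj z * c) \<le> cmod c * r"
        using z mult_right_mono[of "cmod z" r "cmod c"] by (simp add: norm_mult mult.commute)
      then have "cmod (cnj z * c) < 1" using c by linarith
      from sums_mult[OF geometric_deriv_sums[OF this], of "g z"]
      show "(\<Sum>n. g z * (of_nat (Suc n) * (cnj z * c) ^ n)) = g z / (1 - cnj z * c)\<^sup>2"
        by (simp add: sums_iff)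
    qed
  qed simp
  also have "(\<lambda>n. LINT z:ball 0 r|lborel. g z * (of_nat (Suc n) * (cnj z * c) ^ n)) =
     (\<lambda>n. of_real (pi * r\<^sup>2) * (a n * (of_real (r\<^sup>2) * c) ^ n))"
  proof
    fix n
    have "(LINT z:ball 0 r|lborel. g z * (of_nat (Suc n) * (cnj z * c) ^ n))
       = (LINT z:ball 0 r|lborel. of_nat (Suc n) * c ^ n * (g z * cnj z ^ n))"
      by (simp add: power_mult_distrib mult_ac)
    also have "\<dots> = of_nat (Suc n) * c ^ n * (LINT z:ball 0 r|lborel. g z * cnj z ^ n)"
      by (rule set_integral_mult_right)
    also have "\<dots> = of_nat (Suc n) * c ^ n * (of_real (pi * r ^ (2 * n + 2) / (real n + 1)) * a n)"
      by (simp only: taylor_coefficient_disc_integral[OF g r] a_def)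
    also have "\<dots> = of_real (real (Suc n) * (pi * r ^ (2 * n + 2) / (real n + 1))) * (c ^ n * a n)"
      by (simp only: of_real_mult of_real_of_nat_eq mult_ac)
    also have "real (Suc n) * (pi * r ^ (2 * n + 2) / (real n + 1)) = pi * r\<^sup>2 * (r\<^sup>2) ^ n"
    proof -
      have "real (Suc n) * (pi * x / (real n + 1)) = pi * x" for x
        by (simp add: field_simps)
      then show ?thesis
        by (simp add: power_add power_mult power2_eq_square)
    qed
    finally show "(LINT z:ball 0 r|lborel. g z * (of_nat (Suc n) * (cnj z * c) ^ n)) =
        of_real (pi * r\<^sup>2) * (a n * (of_real (r\<^sup>2) * c) ^ n)"
      by (simp add: power_mult_distrib mult_ac)
  qed
  finally have 1: "(\<lambda>n. of_real (pi * r\<^sup>2) * (a n * (of_real (r\<^sup>2) * c) ^ n)) sums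
      (LINT z:ball 0 r|lborel. g z / (1 - cnj z * c)\<^sup>2)" .
  have "r * (cmod c * r) < r * 1"
    using c r by (intro mult_strict_left_mono)
  then have "r * (cmod c * r) < R"
    using r by linarith
  then have "of_real (r\<^sup>2) * c \<in> ball 0 R"
    using r by (auto simp: norm_mult power2_eq_square mult_ac)
  from sums_mult[OF holomorphic_power_series[OF g this], of "of_real (pi * r\<^sup>2)"]
  have 2: "(\<lambda>n. of_real (pi * r\<^sup>2) * (a n * (of_real (r\<^sup>2) * c) ^ n)) sums
      (of_real (pi * r\<^sup>2) * g (of_real (r\<^sup>2) * c))"
    by (simp add: a_def)
  show ?thesis
    using sums_unique2[OF 1 2] .
qed

lemma norm_inverse_power2_bound:
  assumes "cmod x \<le> q" "q < 1"
  shows "cmod (1 / (1 - x)\<^sup>2) \<le> 1 / (1 - q)\<^sup>2"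
proof -
  have "1 - q \<le> cmod (1 - x)"
    using norm_triangle_ineq2[of 1 x] assms by simp
  then have "(1 - q)\<^sup>2 \<le> (cmod (1 - x))\<^sup>2"
    using assms by (intro power_mono) auto
  then show ?thesis
    using assms \<open>1 - q \<le> cmod (1 - x)\<close>
    by (auto simp: norm_divide norm_power intro!: divide_left_mono mult_pos_pos zero_less_power)
qed

text \<open>On the open disk of radius \<open>R\<close> the function \<open>g\<close> may be
  unbounded; the formula is the limit of those for the smaller radii, by dominated convergence.
  With \<open>c = b / R\<^sup>2\<close> it says that the kernel of the disk reproduces
  \<open>g(b)\<close>.\<close>

lemma disc_reproducing:
  assumes g: "g holomorphic_on ball 0 R" and int: "set_integrable lborel (ball 0 R) g"
    and R: "0 < R" and c: "cmod c * R < 1"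
  shows "(LINT z:ball 0 R|lborel. g z / (1 - cnj z * c)\<^sup>2) = of_real (pi * R\<^sup>2) * g (of_real (R\<^sup>2) * c)"
proof -
  have small: "cmod (cnj z * c) \<le> cmod c * R" if "z \<in> ball 0 R" for z
    using that mult_right_mono[of "cmod z" R "cmod c"] by (simp add: norm_mult mult.commute)
  have ne: "1 - cnj z * c \<noteq> 0" if "z \<in> ball 0 R" for z
    using small[OF that] c by auto
  have int': "set_integrable lborel (ball 0 R) (\<lambda>z. g z * (1 / (1 - cnj z * c)\<^sup>2))"
    by (rule set_integrable_bounded_mult[OF int _ _ norm_inverse_power2_bound[OF small c]])
      (use ne in \<open>auto intro!: continuous_intros\<close>)
  define F where "F z = g z / (1 - cnj z * c)\<^sup>2" for z
  have intF: "integrable lborel (\<lambda>z. indicator (ball 0 R) z *\<^sub>R F z)"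
    using int' by (simp add: set_integrable_def F_def)
  (* An increasing sequence of positive radii with limit R. *)
  define \<rho> where "\<rho> k = R * (1 - inverse (real (k + 2)))" for k
  have \<rho>: "0 < \<rho> k" "\<rho> k < R" for k
    using R by (auto simp: \<rho>_def field_simps intro!: add_pos_nonneg)
  have "(\<lambda>k. inverse (real (k + 2))) \<longlonglongrightarrow> 0"
    using LIMSEQ_ignore_initial_segment[OF lim_inverse_n, of 2] by simp
  then have "(\<lambda>k. R * (1 - inverse (real (k + 2)))) \<longlonglongrightarrow> R * (1 - 0)"
    by (intro tendsto_intros)
  then have lim: "\<rho> \<longlonglongrightarrow> R"
    by (simp add: \<rho>_def[abs_def])
  have lim1: "(\<lambda>k. \<integral>z. indicator (ball 0 (\<rho> k)) z *\<^sub>R F z \<partial>lborel) \<longlonglongrightarrow> (\<integral>z. indicator (ball 0 R) z *\<^sub>R F z \<partial>lborel)"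
  proof (rule integral_dominated_convergence[where w = "\<lambda>z. norm (indicator (ball 0 R) z *\<^sub>R F z)"])
    show [measurable]: "(\<lambda>z. indicator (ball 0 R) z *\<^sub>R F z) \<in> borel_measurable lborel"
      using intF by (rule borel_measurable_integrable)
    show "(\<lambda>z. indicator (ball 0 (\<rho> k)) z *\<^sub>R F z) \<in> borel_measurable lborel" for k
    proof -
      have "(\<lambda>z. indicator (ball 0 (\<rho> k)) z *\<^sub>R F z)
          = (\<lambda>z. indicator (ball 0 (\<rho> k)) z *\<^sub>R (indicator (ball 0 R) z *\<^sub>R F z))"
        using \<rho>(2)[of k] by (auto simp: indicator_def)
      moreover have "\<dots> \<in> borel_measurable lborel"
        by (intro borel_measurable_scaleR borel_measurable_indicator
              borel_measurable_integrable[OF intF]) simp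
      ultimately show ?thesis by simp
    qed
    show "integrable lborel (\<lambda>z. norm (indicator (ball 0 R) z *\<^sub>R F z))"
      using intF by (rule integrable_norm)
    show "AE z in lborel. (\<lambda>k. indicator (ball 0 (\<rho> k)) z *\<^sub>R F z) \<longlonglongrightarrow> indicator (ball 0 R) z *\<^sub>R F z"
    proof (rule AE_I2)
      fix z :: complex
      have "eventually (\<lambda>k. indicator (ball 0 (\<rho> k)) z = (indicator (ball 0 R) z :: real)) sequentially"
      proof (cases "cmod z < R")
        case True
        then have "eventually (\<lambda>k. cmod z < \<rho> k) sequentially"
          by (rule order_tendstoD(1)[OF lim])
        then show ?thesis
          by (rule eventually_mono) (use True in \<open>simp add: indicator_def\<close>)
      next
        case False
        then have "\<not> cmod z < \<rho> k" for k using \<rho>(2)[of k] by linarith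
        with False show ?thesis by (simp add: indicator_def)
      qed
      then have "eventually (\<lambda>k. indicator (ball 0 (\<rho> k)) z *\<^sub>R F z = indicator (ball 0 R) z *\<^sub>R F z) sequentially"
        by (rule eventually_mono) simp
      then show "(\<lambda>k. indicator (ball 0 (\<rho> k)) z *\<^sub>R F z) \<longlonglongrightarrow> indicator (ball 0 R) z *\<^sub>R F z"
        by (rule tendsto_eventually)
    qed
    show "AE z in lborel. norm (indicator (ball 0 (\<rho> k)) z *\<^sub>R F z) \<le> norm (indicator (ball 0 R) z *\<^sub>R F z)" for k
      using \<rho>(2)[of k] by (auto simp: indicator_def)
  qed
  have "(\<integral>z. indicator (ball 0 (\<rho> k)) z *\<^sub>R F z \<partial>lborel) = of_real (pi * (\<rho> k)\<^sup>2) * g (of_real ((\<rho> k)\<^sup>2) * c)" for k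
  proof -
    have "cmod c * \<rho> k \<le> cmod c * R" using \<rho>(2)[of k] by (intro mult_left_mono) auto
    then show ?thesis
      using disc_reproducing_inner[OF g \<rho>, of c] c by (simp add: F_def set_lebesgue_integral_def)
  qed
  moreover have "(\<lambda>k. of_real (pi * (\<rho> k)\<^sup>2) * g (of_real ((\<rho> k)\<^sup>2) * c)) \<longlonglongrightarrow> of_real (pi * R\<^sup>2) * g (of_real (R\<^sup>2) * c)"
  proof -
    have "R * (cmod c * R) < R * 1"
      using c R by (intro mult_strict_left_mono)
    then have "R * (cmod c * R) < R"
      by linarith
    then have "of_real (R\<^sup>2) * c \<in> ball 0 R"
      using R by (auto simp: norm_mult power2_eq_square mult_ac)
    then have "isCont g (of_real (R\<^sup>2) * c)"
      using holomorphic_on_imp_continuous_on[OF g] by (simp add: continuous_on_eq_continuous_at)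
    then have "(\<lambda>k. g (of_real ((\<rho> k)\<^sup>2) * c)) \<longlonglongrightarrow> g (of_real (R\<^sup>2) * c)"
      by (rule isCont_tendsto_compose) (intro tendsto_intros lim)
    then show ?thesis
      by (intro tendsto_mult tendsto_of_real tendsto_power tendsto_const lim)
  qed
  ultimately show ?thesis
    using LIMSEQ_unique[OF lim1] by (simp add: F_def set_lebesgue_integral_def)
qed

section \<open>Uniqueness of the Bergman kernel\<close>

text \<open>Evaluate the integral of \<open>K(\<cdot>, w)\<close> against the conjugate of
  \<open>L(\<cdot>, z)\<close> by the reproducing property of \<open>L\<close> and by that of
  \<open>K\<close>. For \<open>K = L\<close> this is Hermitian symmetry, and both cases together
  give uniqueness.\<close>

lemma is_bergman_kernel_hermitian:
  assumes K: "is_bergman_kernel \<Omega> K" and L: "is_bergman_kernel \<Omega> L"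
  shows "K z w = cnj (L w z)"
proof (cases "z \<in> \<Omega> \<and> w \<in> \<Omega>")
  case True
  have "K z w = (LINT x:\<Omega>|lborel. K x w * cnj (L x z))"
    using True K L by (auto simp: is_bergman_kernel_def)
  also have "\<dots> = cnj (LINT x:\<Omega>|lborel. L x z * cnj (K x w))"
    unfolding set_lebesgue_integral_def
    by (subst Bochner_Integration.integral_cnj[symmetric]) (simp add: mult.commute)
  also have "(LINT x:\<Omega>|lborel. L x z * cnj (K x w)) = L w z"
    using True K L by (auto simp: is_bergman_kernel_def)
  finally show ?thesis .
next
  case False
  then show ?thesis using K L by (auto simp: is_bergman_kernel_def)
qed

lemma bergman_kernel_eqI:
  assumes "is_bergman_kernel \<Omega> K"
  shows "bergman_kernel \<Omega> = K"
  unfolding bergman_kernel_def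
proof (rule the_equality)
  show "is_bergman_kernel \<Omega> K" by (rule assms)
  fix L assume L: "is_bergman_kernel \<Omega> L"
  show "L = K"
    using is_bergman_kernel_hermitian[OF L L] is_bergman_kernel_hermitian[OF assms L]
    by (intro ext) metis
qed

section \<open>Holomorphic functions of two variables\<close>

lemma bounded_linear_pt: "bounded_linear (\<lambda>(z, w). pt z w)"
  unfolding linear_conv_bounded_linear[symmetric]
  by (auto intro!: linearI simp: vec_eq_iff pt_def)

lemma has_derivative_pt:
  assumes "(f has_derivative f') (at x within S)" "(g has_derivative g') (at x within S)"
  shows "((\<lambda>x. pt (f x) (g x)) has_derivative (\<lambda>x. pt (f' x) (g' x))) (at x within S)"
  using bounded_linear.has_derivative[OF bounded_linear_pt has_derivative_Pair[OF assms]] by simp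

text \<open>The derivative of a holomorphic function of two variables is complex linear, so its
  restriction to a holomorphic curve has a complex derivative.\<close>

lemma holo_fun_on_curve:
  assumes f: "holo_fun_on \<Omega> f" and S: "open S"
    and a: "a holomorphic_on S" and b: "b holomorphic_on S"
    and sub: "\<And>z. z \<in> S \<Longrightarrow> pt (a z) (b z) \<in> \<Omega>"
  shows "(\<lambda>z. f (pt (a z) (b z))) holomorphic_on S"
  unfolding holomorphic_on_open[OF S]
proof
  fix z assume z: "z \<in> S"
  obtain a' b' where a': "(a has_field_derivative a') (at z)" and b': "(b has_field_derivative b') (at z)"
    using a b z unfolding holomorphic_on_open[OF S] by blast
  obtain f' where f': "(f has_derivative f') (at (pt (a z) (b z)))"
    and lin: "\<And>c v. f' (c *s v) = c * f' v"
    using f sub[OF z] by (auto simp: holo_fun_on_def)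
  have "((\<lambda>z. pt (a z) (b z)) has_derivative (\<lambda>h. pt (a' * h) (b' * h))) (at z)"
    using a' b' unfolding has_field_derivative_def by (rule has_derivative_pt)
  from has_derivative_compose[OF this f']
  have "((\<lambda>z. f (pt (a z) (b z))) has_derivative (\<lambda>h. f' (pt (a' * h) (b' * h)))) (at z)" .
  moreover have "pt (a' * h) (b' * h) = h *s pt a' b'" for h
    by (simp add: vec_eq_iff pt_def)
  then have "(\<lambda>h. f' (pt (a' * h) (b' * h))) = (*) (f' (pt a' b'))"
    by (simp add: lin mult.commute fun_eq_iff)
  ultimately show "\<exists>f'. ((\<lambda>z. f (pt (a z) (b z))) has_field_derivative f') (at z)"
    unfolding has_field_derivative_def by auto
qed

lemma holo_fun_on_const: "holo_fun_on \<Omega> (\<lambda>_. c)"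
  unfolding holo_fun_on_def by (auto intro!: exI[of _ "\<lambda>_. 0"])

lemma holo_fun_on_nth: "holo_fun_on \<Omega> (\<lambda>p. p $ i)"
  unfolding holo_fun_on_def
  by (auto intro!: exI[of _ "\<lambda>p. p $ i"] bounded_linear_imp_has_derivative bounded_linear_vec_nth)

lemma holo_fun_on_mult:
  assumes "holo_fun_on \<Omega> f" "holo_fun_on \<Omega> g"
  shows "holo_fun_on \<Omega> (\<lambda>p. f p * g p)"
  unfolding holo_fun_on_def
proof
  fix p assume p: "p \<in> \<Omega>"
  obtain f' where f': "(f has_derivative f') (at p)" "\<And>c v. f' (c *s v) = c * f' v"
    using assms p by (auto simp: holo_fun_on_def)
  obtain g' where g': "(g has_derivative g') (at p)" "\<And>c v. g' (c *s v) = c * g' v"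
    using assms p by (auto simp: holo_fun_on_def)
  show "\<exists>h. ((\<lambda>p. f p * g p) has_derivative h) (at p) \<and> (\<forall>c v. h (c *s v) = c * h v)"
    by (rule exI, rule conjI, rule has_derivative_mult[OF f'(1) g'(1)])
      (simp add: f' g' algebra_simps)
qed

lemma holo_fun_on_compose:
  assumes f: "holo_fun_on \<Omega> f" and h: "h holomorphic_on S" "open S"
    and sub: "\<And>p. p \<in> \<Omega> \<Longrightarrow> f p \<in> S"
  shows "holo_fun_on \<Omega> (\<lambda>p. h (f p))"
  unfolding holo_fun_on_def
proof
  fix p assume p: "p \<in> \<Omega>"
  obtain f' where f': "(f has_derivative f') (at p)" "\<And>c v. f' (c *s v) = c * f' v"
    using f p by (auto simp: holo_fun_on_def)
  obtain h' where h': "(h has_field_derivative h') (at (f p))"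
    using h sub[OF p] by (auto simp: holomorphic_on_open)
  show "\<exists>k. ((\<lambda>p. h (f p)) has_derivative k) (at p) \<and> (\<forall>c v. k (c *s v) = c * k v)"
    by (rule exI, rule conjI, rule has_derivative_compose[OF f'(1) h'[unfolded has_field_derivative_def]])
      (simp add: f' algebra_simps)
qed

lemma holo_fun_on_transform:
  assumes "open \<Omega>" "holo_fun_on \<Omega> f" "\<And>p. p \<in> \<Omega> \<Longrightarrow> g p = f p"
  shows "holo_fun_on \<Omega> g"
  unfolding holo_fun_on_def
proof
  fix p assume p: "p \<in> \<Omega>"
  obtain f' where f': "(f has_derivative f') (at p)" "\<forall>c v. f' (c *s v) = c * f' v"
    using assms(2) p by (auto simp: holo_fun_on_def)
  have "(g has_derivative f') (at p)"
    by (rule has_derivative_transform_within_open[OF f'(1) assms(1) p]) (simp add: assms(3))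
  with f'(2) show "\<exists>f'. (g has_derivative f') (at p) \<and> (\<forall>c v. f' (c *s v) = c * f' v)"
    by blast
qed

lemma holo_fun_on_imp_continuous_on: "holo_fun_on \<Omega> f \<Longrightarrow> continuous_on \<Omega> f"
  unfolding holo_fun_on_def
  by (meson continuous_at_imp_continuous_on has_derivative_continuous)

lemma nn_integral_complex2_iterated:
  assumes [measurable]: "f \<in> borel_measurable borel"
  shows "(\<integral>\<^sup>+p. f p \<partial>lborel) = (\<integral>\<^sup>+z. \<integral>\<^sup>+w. f (pt z w) \<partial>lborel \<partial>lborel)"
proof -
  have "(\<integral>\<^sup>+p. f p \<partial>lborel) = (\<integral>\<^sup>+x. f (case x of (z, w) \<Rightarrow> pt z w) \<partial>(lborel \<Otimes>\<^sub>M lborel))"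
    by (subst lborel_complex2_eq_distr[symmetric], subst nn_integral_distr) simp_all
  also have "\<dots> = (\<integral>\<^sup>+z. \<integral>\<^sup>+w. f (pt z w) \<partial>lborel \<partial>lborel)"
    by (subst lborel.nn_integral_fst[symmetric]) simp_all
  finally show ?thesis .
qed

lemma integral_complex2_iterated:
  fixes f :: "complex^2 \<Rightarrow> complex"
  assumes f: "integrable lborel f"
  shows "AE z in lborel. integrable lborel (\<lambda>w. f (pt z w))"
    and "integrable lborel (\<lambda>z. \<integral>w. f (pt z w) \<partial>lborel)"
    and "(\<integral>p. f p \<partial>lborel) = (\<integral>z. \<integral>w. f (pt z w) \<partial>lborel \<partial>lborel)"
proof -
  have [measurable]: "f \<in> borel_measurable borel"
    using borel_measurable_integrable[OF f] by simp
  have [measurable]: "(\<lambda>(z, w). pt z w) \<in> lborel \<Otimes>\<^sub>M lborel \<rightarrow>\<^sub>M borel"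
    using measurable_pt by simp
  define F where "F x = f (case x of (z, w) \<Rightarrow> pt z w)" for x
  have F: "integrable (lborel \<Otimes>\<^sub>M lborel) F"
    using f integrable_distr_eq[of "\<lambda>(z, w). pt z w" "lborel \<Otimes>\<^sub>M lborel" borel f]
    by (simp add: lborel_complex2_eq_distr F_def[abs_def])
  have "(\<integral>p. f p \<partial>lborel) = integral\<^sup>L (lborel \<Otimes>\<^sub>M lborel) F"
    unfolding F_def
    by (subst lborel_complex2_eq_distr[symmetric], subst integral_distr) simp_all
  then show "(\<integral>p. f p \<partial>lborel) = (\<integral>z. \<integral>w. f (pt z w) \<partial>lborel \<partial>lborel)"
    using lborel_pair.integral_fst'[OF F] by (simp add: F_def)
  show "AE z in lborel. integrable lborel (\<lambda>w. f (pt z w))"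
    using lborel_pair.AE_integrable_fst'[OF F] by (simp add: F_def)
  show "integrable lborel (\<lambda>z. \<integral>w. f (pt z w) \<partial>lborel)"
    using lborel_pair.integrable_fst'[OF F] by (simp add: F_def)
qed

section \<open>The Bergman kernel of a Hartogs domain over the disk\<close>

definition hartogs :: "(complex \<Rightarrow> complex) \<Rightarrow> (complex^2) set" where
  "hartogs E = {p. cmod (p $ 1) < 1 \<and> cmod (p $ 2 * E (p $ 1)) < 1}"

lemma pt_in_hartogs: "pt z w \<in> hartogs E \<longleftrightarrow> cmod z < 1 \<and> cmod (w * E z) < 1"
  by (simp add: hartogs_def)

lemma hartogs_fibre:
  assumes "cmod z < 1" "E z \<noteq> 0"
  shows "pt z w \<in> hartogs E \<longleftrightarrow> w \<in> ball 0 (1 / cmod (E z))"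
  using assms by (simp add: pt_in_hartogs norm_mult field_simps)

lemma holo_fun_on_hartogs_weight:
  assumes E: "E holomorphic_on ball 0 1"
  shows "holo_fun_on (hartogs E) (\<lambda>p. E (p $ 1))"
  by (rule holo_fun_on_compose[OF holo_fun_on_nth E]) (auto simp: hartogs_def)

lemma holo_fun_on_hartogs_fibre_coord:
  assumes E: "E holomorphic_on ball 0 1"
  shows "holo_fun_on (hartogs E) (\<lambda>p. p $ 2 * E (p $ 1))"
  by (intro holo_fun_on_mult holo_fun_on_nth holo_fun_on_hartogs_weight E)

lemma open_hartogs:
  assumes E: "E holomorphic_on ball 0 1"
  shows "open (hartogs E)"
proof -
  define U where "U = {p :: complex^2. cmod (p $ 1) < 1}"
  have U: "open U"
    unfolding U_def by (intro open_Collect_less continuous_intros)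
  have "holo_fun_on U (\<lambda>p. p $ 2 * E (p $ 1))"
    by (intro holo_fun_on_mult holo_fun_on_nth holo_fun_on_compose[OF holo_fun_on_nth E])
      (auto simp: U_def)
  then have "continuous_on U (\<lambda>p. p $ 2 * E (p $ 1))"
    by (rule holo_fun_on_imp_continuous_on)
  then have "open (U \<inter> (\<lambda>p. p $ 2 * E (p $ 1)) -` ball 0 1)"
    by (rule continuous_open_preimage) (auto simp: U)
  also have "U \<inter> (\<lambda>p. p $ 2 * E (p $ 1)) -` ball 0 1 = hartogs E"
    by (auto simp: U_def hartogs_def)
  finally show ?thesis .
qed

definition hartogs_kernel :: "(complex \<Rightarrow> complex) \<Rightarrow> complex^2 \<Rightarrow> complex^2 \<Rightarrow> complex" where
  "hartogs_kernel E p q =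
     (if p \<in> hartogs E \<and> q \<in> hartogs E
      then E (p $ 1) * cnj (E (q $ 1)) /
        (of_real (pi\<^sup>2) * (1 - p $ 1 * cnj (q $ 1))\<^sup>2 * (1 - p $ 2 * E (p $ 1) * cnj (q $ 2 * E (q $ 1)))\<^sup>2)
      else 0)"

lemma mult_cnj_disc:
  assumes "cmod x < 1" "cmod y < 1"
  shows "cmod (x * cnj y) \<le> cmod y" "x * cnj y \<noteq> 1"
proof -
  show *: "cmod (x * cnj y) \<le> cmod y"
    using assms mult_right_mono[of "cmod x" 1 "cmod y"] by (simp add: norm_mult)
  show "x * cnj y \<noteq> 1"
    using * assms(2) by auto
qed

text \<open>For fixed \<open>q\<close> the denominator of the kernel is bounded away from
  \<open>0\<close>, so \<open>\<bar>K(p, q)\<bar> \<le> C \<bar>E(z)\<bar>\<close> at \<open>p =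
  (z, w)\<close>. The fibre over \<open>z\<close> has area \<open>\<pi> /
  \<bar>E(z)\<bar>\<^sup>2\<close>, so each fibre contributes at most \<open>C\<^sup>2
  \<pi>\<close>.\<close>

lemma hartogs_kernel_in_bergman_space:
  assumes E: "E holomorphic_on ball 0 1" and nz: "\<And>z. cmod z < 1 \<Longrightarrow> E z \<noteq> 0"
    and q: "q \<in> hartogs E"
  shows "(\<lambda>p. hartogs_kernel E p q) \<in> bergman_space (hartogs E)"
proof -
  let ?\<Omega> = "hartogs E"
  define a u where "a = q $ 1" and "u = q $ 2 * E (q $ 1)"
  have a: "cmod a < 1" and u: "cmod u < 1"
    using q by (auto simp: hartogs_def a_def u_def)
  define h where "h b x = 1 / (1 - x * cnj b)\<^sup>2" for b x :: complex
  have h_holo: "h b holomorphic_on ball 0 1" if "cmod b < 1" for b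
    unfolding h_def using that mult_cnj_disc[of _ b] by (intro holomorphic_intros) auto
  have h_bound: "cmod (h b x) \<le> 1 / (1 - cmod b)\<^sup>2" if "cmod b < 1" "cmod x < 1" for b x
    unfolding h_def by (rule norm_inverse_power2_bound) (use that mult_cnj_disc in auto)
  define K where "K p = E (p $ 1) * (cnj (E a) / of_real (pi\<^sup>2)) * h a (p $ 1) * h u (p $ 2 * E (p $ 1))" for p :: "complex^2"
  have eq: "hartogs_kernel E p q = K p" if "p \<in> ?\<Omega>" for p
    using that q by (simp add: hartogs_kernel_def K_def h_def a_def u_def)
  have "holo_fun_on ?\<Omega> K"
    unfolding K_def
    by (intro holo_fun_on_mult holo_fun_on_const holo_fun_on_hartogs_weight E
        holo_fun_on_compose[OF holo_fun_on_nth h_holo[OF a]]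
        holo_fun_on_compose[OF holo_fun_on_hartogs_fibre_coord[OF E] h_holo[OF u]])
      (auto simp: hartogs_def)
  then have holo: "holo_fun_on ?\<Omega> (\<lambda>p. hartogs_kernel E p q)"
    by (rule holo_fun_on_transform[OF open_hartogs[OF E]]) (rule eq)
  (* C bounds the product of all factors of the kernel other than E z. *)
  define C where "C = cmod (E a) / pi\<^sup>2 * (1 / (1 - cmod a)\<^sup>2) * (1 / (1 - cmod u)\<^sup>2)"
  have bound: "cmod (K p) \<le> C * cmod (E (p $ 1))" if "p \<in> ?\<Omega>" for p
  proof -
    have "cmod (K p) = cmod (E (p $ 1)) * (cmod (E a) / pi\<^sup>2) * cmod (h a (p $ 1)) * cmod (h u (p $ 2 * E (p $ 1)))"
      by (simp add: K_def norm_mult norm_divide norm_power)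
    also have "\<dots> \<le> cmod (E (p $ 1)) * (cmod (E a) / pi\<^sup>2) * (1 / (1 - cmod a)\<^sup>2) * (1 / (1 - cmod u)\<^sup>2)"
      using that a u by (intro mult_mono h_bound mult_nonneg_nonneg) (auto simp: hartogs_def)
    finally show ?thesis by (simp add: C_def mult_ac)
  qed
  define F where "F p = indicator ?\<Omega> p *\<^sub>R (cmod (hartogs_kernel E p q))\<^sup>2" for p
  have meas [measurable]: "F \<in> borel_measurable borel"
    unfolding F_def using open_hartogs[OF E]
    by (intro borel_measurable_continuous_on_indicator continuous_intros
        holo_fun_on_imp_continuous_on[OF holo]) auto
  have "(\<integral>\<^sup>+p. F p \<partial>lborel) = (\<integral>\<^sup>+z. \<integral>\<^sup>+w. F (pt z w) \<partial>lborel \<partial>lborel)"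
    by (rule nn_integral_complex2_iterated) simp
  also have "\<dots> \<le> (\<integral>\<^sup>+z. ennreal (C\<^sup>2 * pi) * indicator (ball 0 1) (z::complex) \<partial>lborel)"
  proof (rule nn_integral_mono)
    fix z :: complex
    show "(\<integral>\<^sup>+w. F (pt z w) \<partial>lborel) \<le> ennreal (C\<^sup>2 * pi) * indicator (ball 0 1) z"
    proof (cases "cmod z < 1")
      case False
      then show ?thesis by (simp add: F_def pt_in_hartogs)
    next
      case True
      note Ez = nz[OF True]
      have "(\<integral>\<^sup>+w. F (pt z w) \<partial>lborel) \<le>
          (\<integral>\<^sup>+w. ennreal ((C * cmod (E z))\<^sup>2) * indicator (ball 0 (1 / cmod (E z))) (w::complex) \<partial>lborel)"
      proof (rule nn_integral_mono)
        fix w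
        show "ennreal (F (pt z w)) \<le> ennreal ((C * cmod (E z))\<^sup>2) * indicator (ball 0 (1 / cmod (E z))) w"
        proof (cases "pt z w \<in> ?\<Omega>")
          case in\<Omega>: True
          then have "F (pt z w) \<le> (C * cmod (E z))\<^sup>2"
            using bound[OF in\<Omega>] by (simp add: F_def eq power_mono)
          with in\<Omega> show ?thesis
            using hartogs_fibre[of z E w, OF True Ez] by (simp add: ennreal_leI)
        qed (simp add: F_def)
      qed
      also have "\<dots> = ennreal ((C * cmod (E z))\<^sup>2) * ennreal (pi * (1 / cmod (E z))\<^sup>2)"
        by (simp add: nn_integral_cmult_indicator emeasure_ball unit_ball_vol_2)
      also have "\<dots> = ennreal (C\<^sup>2 * pi)"
        using Ez by (subst ennreal_mult[symmetric]) (auto simp: power_mult_distrib field_simps)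
      finally show ?thesis using True by simp
    qed
  qed
  also have "\<dots> < \<infinity>"
    using emeasure_disc_finite[of 1] by (simp add: nn_integral_cmult_indicator ennreal_mult_less_top)
  finally have "integrable lborel F"
    by (intro integrableI_bounded) (auto simp: F_def)
  with holo show ?thesis
    by (simp add: bergman_space_def set_integrable_def F_def[abs_def])
qed


lemma set_integrable_bergman_pair:
  assumes \<Omega>: "open \<Omega>" and f: "f \<in> bergman_space \<Omega>" and g: "g \<in> bergman_space \<Omega>"
  shows "set_integrable lborel \<Omega> (\<lambda>p. f p * cnj (g p))"
  unfolding set_integrable_def
proof (rule Bochner_Integration.integrable_bound)
  show "integrable lborel (\<lambda>p. indicator \<Omega> p *\<^sub>R (cmod (f p))\<^sup>2 + indicator \<Omega> p *\<^sub>R (cmod (g p))\<^sup>2)"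
    using f g by (intro Bochner_Integration.integrable_add) (auto simp: bergman_space_def set_integrable_def)
  have "continuous_on \<Omega> f" "continuous_on \<Omega> g"
    using f g by (auto simp: bergman_space_def intro: holo_fun_on_imp_continuous_on)
  then have "set_borel_measurable lborel \<Omega> (\<lambda>p. f p * cnj (g p))"
    using \<Omega> by (intro set_borel_measurable_continuous_on continuous_intros) auto
  then show "(\<lambda>p. indicator \<Omega> p *\<^sub>R (f p * cnj (g p))) \<in> borel_measurable lborel"
    by (simp add: set_borel_measurable_def)
  have "x * y \<le> x\<^sup>2 + y\<^sup>2" if "x \<ge> 0" "y \<ge> 0" for x y :: real
    using sum_squares_bound[of x y] mult_nonneg_nonneg[OF that] by linarith
  then have "cmod (f p) * cmod (g p) \<le> (cmod (f p))\<^sup>2 + (cmod (g p))\<^sup>2" for p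
    by simp
  then show "AE p in lborel. norm (indicator \<Omega> p *\<^sub>R (f p * cnj (g p)))
      \<le> norm (indicator \<Omega> p *\<^sub>R (cmod (f p))\<^sup>2 + indicator \<Omega> p *\<^sub>R (cmod (g p))\<^sup>2)"
    by (auto simp: indicator_def norm_mult)
qed

text \<open>On the fibre over \<open>z\<close>, a disk of radius \<open>\<rho> = 1 /
  \<bar>E(z)\<bar>\<close>, the conjugate kernel is a constant times \<open>1 / (1 - cnj w
  c)\<^sup>2\<close> with \<open>c = cnj (E(z)) u\<close> and \<open>u = b E(a)\<close> for
  \<open>q = (a, b)\<close>. The formula for the disk evaluates \<open>f(z, \<cdot>)\<close> at
  \<open>\<rho>\<^sup>2 c = u / E(z)\<close>.\<close>

lemma hartogs_kernel_fibre_integral: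
  assumes E: "E holomorphic_on ball 0 1" and nz: "\<And>z. cmod z < 1 \<Longrightarrow> E z \<noteq> 0"
    and q: "q \<in> hartogs E" and z: "cmod z < 1"
    and f: "holo_fun_on (hartogs E) f"
    and int: "integrable lborel (\<lambda>w. indicator (hartogs E) (pt z w) *\<^sub>R (f (pt z w) * cnj (hartogs_kernel E (pt z w) q)))"
  shows "(\<integral>w. indicator (hartogs E) (pt z w) *\<^sub>R (f (pt z w) * cnj (hartogs_kernel E (pt z w) q)) \<partial>lborel) =
    E (q $ 1) / E z * f (pt z (q $ 2 * E (q $ 1) / E z)) / (1 - cnj z * q $ 1)\<^sup>2 / of_real pi"
proof -
  define a u \<rho> where "a = q $ 1" and "u = q $ 2 * E (q $ 1)" and "\<rho> = 1 / cmod (E z)"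
  have a: "cmod a < 1" and u: "cmod u < 1"
    using q by (auto simp: hartogs_def a_def u_def)
  have Ez: "E z \<noteq> 0" using nz z by blast
  have \<rho>: "\<rho> > 0" using Ez by (simp add: \<rho>_def)
  define c where "c = cnj (E z) * u"
  have c\<rho>: "cmod c * \<rho> < 1" using Ez u by (simp add: c_def \<rho>_def norm_mult)
  have za: "1 - cnj z * a \<noteq> 0"
    using mult_cnj_disc(2)[OF a z] by (simp add: mult.commute)
  define k where "k = cnj (E z) * E a / (of_real (pi\<^sup>2) * (1 - cnj z * a)\<^sup>2)"
  have k: "k \<noteq> 0"
    using Ez nz[OF a] za by (simp add: k_def)
  define g where "g w = f (pt z w)" for w
  have fib: "pt z w \<in> hartogs E \<longleftrightarrow> w \<in> ball 0 \<rho>" for w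
    unfolding \<rho>_def using z Ez by (rule hartogs_fibre)
  have integrand: "indicator (hartogs E) (pt z w) *\<^sub>R (f (pt z w) * cnj (hartogs_kernel E (pt z w) q))
      = indicator (ball 0 \<rho>) w *\<^sub>R (k * (g w / (1 - cnj w * c)\<^sup>2))" for w
  proof (cases "w \<in> ball 0 \<rho>")
    case True
    then have "hartogs_kernel E (pt z w) q
      = E z * cnj (E a) / (of_real (pi\<^sup>2) * (1 - z * cnj a)\<^sup>2 * (1 - w * E z * cnj u)\<^sup>2)"
      using q fib by (simp add: hartogs_kernel_def a_def u_def)
    then show ?thesis
      using True fib by (simp add: k_def g_def c_def mult_ac)
  qed (simp add: fib)
  have cw: "1 - cnj w * c \<noteq> 0" "cmod ((1 - cnj w * c)\<^sup>2 / k) \<le> 4 / cmod k" if "w \<in> ball 0 \<rho>" for w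
  proof -
    have "cmod w * cmod c \<le> \<rho> * cmod c"
      using that by (intro mult_right_mono) auto
    then have less: "cmod (cnj w * c) < 1"
      using c\<rho> by (simp add: norm_mult mult.commute)
    then show "1 - cnj w * c \<noteq> 0" by auto
    have "cmod (1 - cnj w * c) \<le> 2"
      using norm_triangle_ineq4[of 1 "cnj w * c"] less by simp
    then have "(cmod (1 - cnj w * c))\<^sup>2 \<le> 2\<^sup>2"
      by (intro power_mono) auto
    then show "cmod ((1 - cnj w * c)\<^sup>2 / k) \<le> 4 / cmod k"
      by (simp add: norm_divide norm_power divide_right_mono)
  qed
  (* The kernel is bounded below on the fibre, so dividing by it shows that g is integrable. *)
  have "set_integrable lborel (ball 0 \<rho>) (\<lambda>w. k * (g w / (1 - cnj w * c)\<^sup>2))"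
    using int unfolding integrand set_integrable_def .
  then have "set_integrable lborel (ball 0 \<rho>) (\<lambda>w. k * (g w / (1 - cnj w * c)\<^sup>2) * ((1 - cnj w * c)\<^sup>2 / k))"
    by (rule set_integrable_bounded_mult[OF _ _ _ cw(2)]) (auto intro!: continuous_intros simp: k)
  also have "?this \<longleftrightarrow> set_integrable lborel (ball 0 \<rho>) g"
    by (rule set_integrable_cong) (use k cw(1) in auto)
  finally have g_int: "set_integrable lborel (ball 0 \<rho>) g" .
  have g: "g holomorphic_on ball 0 \<rho>"
    unfolding g_def using fib by (intro holo_fun_on_curve[OF f] holomorphic_intros) auto
  have \<rho>2: "of_real (\<rho>\<^sup>2) * cnj (E z) = 1 / E z"
    using Ez complex_norm_square[of "E z"] by (simp add: \<rho>_def power_divide field_simps)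
  have "(\<integral>w. indicator (hartogs E) (pt z w) *\<^sub>R (f (pt z w) * cnj (hartogs_kernel E (pt z w) q)) \<partial>lborel)
      = (LINT w:ball 0 \<rho>|lborel. k * (g w / (1 - cnj w * c)\<^sup>2))"
    by (simp only: integrand set_lebesgue_integral_def)
  also have "\<dots> = k * (LINT w:ball 0 \<rho>|lborel. g w / (1 - cnj w * c)\<^sup>2)"
    by (rule set_integral_mult_right)
  also have "\<dots> = k * (of_real (pi * \<rho>\<^sup>2) * g (of_real (\<rho>\<^sup>2) * c))"
    by (simp only: disc_reproducing[OF g g_int \<rho> c\<rho>])
  also have "\<dots> = (of_real (\<rho>\<^sup>2) * cnj (E z)) * E a * g ((of_real (\<rho>\<^sup>2) * cnj (E z)) * u)
      / (1 - cnj z * a)\<^sup>2 / of_real pi"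
    using za by (simp add: k_def c_def power2_eq_square[of pi] field_simps)
  also have "\<dots> = E a / E z * f (pt z (u / E z)) / (1 - cnj z * a)\<^sup>2 / of_real pi"
    unfolding \<rho>2 g_def by simp
  finally show ?thesis by (simp only: a_def u_def)
qed

text \<open>After integration over the fibres, what remains is the kernel of the unit disk
  against \<open>e(z) = E(a) / E(z) f(z, u / E(z))\<close>. This function is holomorphic, and
  \<open>e(a) = f(a, b)\<close>. Fubini gives integrability on almost every fibre and of
  \<open>e\<close> on the base, which is what the formula for the disk requires.\<close>

lemma hartogs_kernel_reproducing:
  assumes E: "E holomorphic_on ball 0 1" and nz: "\<And>z. cmod z < 1 \<Longrightarrow> E z \<noteq> 0"
    and q: "q \<in> hartogs E" and f: "f \<in> bergman_space (hartogs E)"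
  shows "f q = (LINT p:hartogs E|lborel. f p * cnj (hartogs_kernel E p q))"
proof -
  define a u where "a = q $ 1" and "u = q $ 2 * E (q $ 1)"
  have a: "cmod a < 1" and u: "cmod u < 1"
    using q by (auto simp: hartogs_def a_def u_def)
  have holo: "holo_fun_on (hartogs E) f"
    using f by (simp add: bergman_space_def)
  define \<phi> where "\<phi> p = indicator (hartogs E) p *\<^sub>R (f p * cnj (hartogs_kernel E p q))" for p
  have \<phi>: "integrable lborel \<phi>"
    using set_integrable_bergman_pair[OF open_hartogs[OF E] f hartogs_kernel_in_bergman_space[OF E nz q]]
    by (simp add: set_integrable_def \<phi>_def[abs_def])
  define e where "e z = E a / E z * f (pt z (u / E z))" for z
  have e: "e holomorphic_on ball 0 1"
    unfolding e_def using u nz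
    by (intro holomorphic_intros E holo_fun_on_curve[OF holo]) (auto simp: pt_in_hartogs)
  have za: "1 - cnj z * a \<noteq> 0" if "z \<in> ball 0 1" for z
    using mult_cnj_disc(2)[OF a, of z] that by (simp add: mult.commute)
  have inner: "AE z in lborel. (\<integral>w. \<phi> (pt z w) \<partial>lborel) = indicator (ball 0 1) z *\<^sub>R (e z / (1 - cnj z * a)\<^sup>2 / of_real pi)"
    using integral_complex2_iterated(1)[OF \<phi>]
  proof eventually_elim
    fix z assume int: "integrable lborel (\<lambda>w. \<phi> (pt z w))"
    show "(\<integral>w. \<phi> (pt z w) \<partial>lborel) = indicator (ball 0 1) z *\<^sub>R (e z / (1 - cnj z * a)\<^sup>2 / of_real pi)"
    proof (cases "cmod z < 1")
      case True
      show ?thesis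
        using hartogs_kernel_fibre_integral[OF E nz q True holo int[unfolded \<phi>_def]] True
        by (simp add: \<phi>_def e_def a_def u_def)
    next
      case False
      then show ?thesis by (simp add: \<phi>_def pt_in_hartogs)
    qed
  qed
  have meas: "(\<lambda>z. indicator (ball 0 1) z *\<^sub>R (e z / (1 - cnj z * a)\<^sup>2 / of_real pi)) \<in> borel_measurable lborel"
    unfolding set_borel_measurable_def[symmetric] using za
    by (intro set_borel_measurable_continuous_on continuous_intros
        holomorphic_on_imp_continuous_on[OF e]) auto
  have meas': "(\<lambda>z. \<integral>w. \<phi> (pt z w) \<partial>lborel) \<in> borel_measurable lborel"
    using integral_complex2_iterated(2)[OF \<phi>] by (rule borel_measurable_integrable)
  have int1: "set_integrable lborel (ball 0 1) (\<lambda>z. e z / (1 - cnj z * a)\<^sup>2 / of_real pi)"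
    using integral_complex2_iterated(2)[OF \<phi>] integrable_cong_AE[OF meas' meas inner]
    by (simp add: set_integrable_def)
  (* The kernel of the base is bounded below as well, so e is integrable. *)
  have bound: "cmod ((1 - cnj z * a)\<^sup>2 * of_real pi) \<le> 4 * pi" if "z \<in> ball 0 1" for z
  proof -
    have "cmod (1 - cnj z * a) \<le> 2"
      using norm_triangle_ineq4[of 1 "cnj z * a"] mult_cnj_disc(1)[OF a, of z] that
      by (simp add: mult.commute)
    then have "(cmod (1 - cnj z * a))\<^sup>2 \<le> 2\<^sup>2"
      by (intro power_mono) auto
    then show ?thesis
      by (simp add: norm_mult norm_power)
  qed
  have "set_integrable lborel (ball 0 1) (\<lambda>z. e z / (1 - cnj z * a)\<^sup>2 / of_real pi * ((1 - cnj z * a)\<^sup>2 * of_real pi))"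
    by (rule set_integrable_bounded_mult[OF int1 _ _ bound]) (auto intro!: continuous_intros)
  also have "?this \<longleftrightarrow> set_integrable lborel (ball 0 1) e"
    by (rule set_integrable_cong) (use za in auto)
  finally have e_int: "set_integrable lborel (ball 0 1) e" .
  have "(LINT p:hartogs E|lborel. f p * cnj (hartogs_kernel E p q)) = (\<integral>p. \<phi> p \<partial>lborel)"
    by (simp add: set_lebesgue_integral_def \<phi>_def)
  also have "\<dots> = (\<integral>z. \<integral>w. \<phi> (pt z w) \<partial>lborel \<partial>lborel)"
    by (rule integral_complex2_iterated(3)[OF \<phi>])
  also have "\<dots> = (\<integral>z. indicator (ball 0 1) z *\<^sub>R (e z / (1 - cnj z * a)\<^sup>2 / of_real pi) \<partial>lborel)"
    by (rule integral_cong_AE[OF meas' meas inner])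
  also have "\<dots> = (LINT z:ball 0 1|lborel. e z / (1 - cnj z * a)\<^sup>2 / of_real pi)"
    by (simp only: set_lebesgue_integral_def)
  also have "\<dots> = (LINT z:ball 0 1|lborel. e z / (1 - cnj z * a)\<^sup>2) / of_real pi"
    by (rule set_integral_divide_zero)
  also have "\<dots> = e a"
    using disc_reproducing[OF e e_int, of a] a by simp
  also have "\<dots> = f q"
    using nz[OF a] pt_eta[of q] by (simp add: e_def a_def u_def)
  finally show ?thesis ..
qed

theorem bergman_kernel_hartogs:
  assumes "E holomorphic_on ball 0 1" and "\<And>z. cmod z < 1 \<Longrightarrow> E z \<noteq> 0"
  shows "bergman_kernel (hartogs E) = hartogs_kernel E"
proof (rule bergman_kernel_eqI)
  show "is_bergman_kernel (hartogs E) (hartogs_kernel E)"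
    unfolding is_bergman_kernel_def
    using hartogs_kernel_in_bergman_space[OF assms] hartogs_kernel_reproducing[OF assms]
    by (auto simp: hartogs_kernel_def[of E])
qed

section \<open>Wirtinger derivatives in two variables\<close>

text \<open>The numbers \<open>a, b, c, d\<close> are the derivatives with respect to
  \<open>z\<^sub>1\<close>, \<open>z\<^sub>2\<close> and the conjugates of
  \<open>z\<^sub>1\<close>, \<open>z\<^sub>2\<close>. Real differentiability is part of the
  notion, so that the chain rule holds.\<close>

definition has_wirtinger ::
  "(complex^2 \<Rightarrow> complex) \<Rightarrow> complex \<Rightarrow> complex \<Rightarrow> complex \<Rightarrow> complex \<Rightarrow> complex^2 \<Rightarrow> bool" where
  "has_wirtinger f a b c d p \<longleftrightarrow>
     (f has_derivative (\<lambda>v. a * v $ 1 + b * v $ 2 + c * cnj (v $ 1) + d * cnj (v $ 2))) (at p)"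

lemma dir_deriv_eq:
  assumes "(f has_derivative f') (at p)"
  shows "dir_deriv v f p = f' v"
proof -
  have "((\<lambda>t::real. p + t *\<^sub>R v) has_derivative (\<lambda>t. t *\<^sub>R v)) (at 0)"
    by (auto intro!: derivative_eq_intros)
  moreover have "(f has_derivative f') (at (p + 0 *\<^sub>R v))"
    using assms by simp
  ultimately have "((\<lambda>t. f (p + t *\<^sub>R v)) has_derivative (\<lambda>t. f' (t *\<^sub>R v))) (at (0::real))"
    by (rule has_derivative_compose)
  moreover have "f' (t *\<^sub>R v) = t *\<^sub>R f' v" for t
    using has_derivative_bounded_linear[OF assms] by (simp add: linear_simps)
  ultimately have "((\<lambda>t. f (p + t *\<^sub>R v)) has_vector_derivative f' v) (at 0)"
    by (simp add: has_vector_derivative_def)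
  then show ?thesis
    unfolding dir_deriv_def by (rule vector_derivative_at)
qed

lemma has_wirtinger_imp_dz:
  assumes "has_wirtinger f a b c d p"
  shows "dz 1 f p = a" "dz 2 f p = b" "dzbar 1 f p = c" "dzbar 2 f p = d"
proof -
  have *: "dir_deriv v f p = a * v $ 1 + b * v $ 2 + c * cnj (v $ 1) + d * cnj (v $ 2)" for v
    using assms unfolding has_wirtinger_def by (rule dir_deriv_eq)
  show "dz 1 f p = a" "dz 2 f p = b" "dzbar 1 f p = c" "dzbar 2 f p = d"
    by (simp_all add: dz_def dzbar_def * axis_def algebra_simps)
qed

lemma has_wirtinger_const: "has_wirtinger (\<lambda>_. k) 0 0 0 0 p"
  by (simp add: has_wirtinger_def)

lemma has_wirtinger_nth:
  "has_wirtinger (\<lambda>p. p $ 1) 1 0 0 0 p" "has_wirtinger (\<lambda>p. p $ 2) 0 1 0 0 p"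
  by (auto simp: has_wirtinger_def intro!: bounded_linear_imp_has_derivative bounded_linear_vec_nth)

lemma has_wirtinger_cnj:
  assumes "has_wirtinger f a b c d p"
  shows "has_wirtinger (\<lambda>p. cnj (f p)) (cnj c) (cnj d) (cnj a) (cnj b) p"
  using bounded_linear.has_derivative[OF bounded_linear_cnj assms[unfolded has_wirtinger_def]]
  by (simp add: has_wirtinger_def algebra_simps)

lemma has_wirtinger_add:
  assumes "has_wirtinger f a b c d p" "has_wirtinger g a' b' c' d' p"
  shows "has_wirtinger (\<lambda>p. f p + g p) (a + a') (b + b') (c + c') (d + d') p"
  using has_derivative_add[OF assms[unfolded has_wirtinger_def]]
  by (simp add: has_wirtinger_def algebra_simps)

lemma has_wirtinger_mult:
  assumes "has_wirtinger f a b c d p" "has_wirtinger g a' b' c' d' p"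
  shows "has_wirtinger (\<lambda>p. f p * g p) (a * g p + f p * a') (b * g p + f p * b')
           (c * g p + f p * c') (d * g p + f p * d') p"
  using has_derivative_mult[OF assms[unfolded has_wirtinger_def]]
  by (simp add: has_wirtinger_def algebra_simps)

lemma has_wirtinger_holomorphic:
  assumes "has_wirtinger f a b c d p" "(h has_field_derivative h') (at (f p))"
  shows "has_wirtinger (\<lambda>p. h (f p)) (h' * a) (h' * b) (h' * c) (h' * d) p"
  using has_derivative_compose[OF assms(1)[unfolded has_wirtinger_def] assms(2)[unfolded has_field_derivative_def]]
  by (simp add: has_wirtinger_def algebra_simps)

lemma has_wirtinger_transform:
  assumes "has_wirtinger f a b c d p" "open S" "p \<in> S" "\<And>x. x \<in> S \<Longrightarrow> g x = f x"
  shows "has_wirtinger g a b c d p"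
  using assms(1) unfolding has_wirtinger_def
  by (rule has_derivative_transform_within_open[OF _ assms(2,3)]) (simp add: assms(4))

section \<open>The Bergman metric and the derivative of the logarithm of the kernel\<close>

text \<open>Written with \<open>h\<close>, its conjugate and the complex logarithm, the function
  becomes accessible to the rules for Wirtinger derivatives.\<close>

lemma log_bergman_hartogs:
  assumes h: "h holomorphic_on ball 0 1" and p: "p \<in> hartogs (\<lambda>z. exp (h z))"
  shows "complex_of_real (log_bergman (hartogs (\<lambda>z. exp (h z))) p) =
    of_real (- ln (pi\<^sup>2)) + h (p $ 1) + cnj (h (p $ 1)) + (- 2) * Ln (1 - p $ 1 * cnj (p $ 1))
      + (- 2) * Ln (1 - p $ 2 * exp (h (p $ 1)) * cnj (p $ 2 * exp (h (p $ 1))))"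
proof -
  define E where "E = (\<lambda>z. exp (h z))"
  define x y where "x = 1 - (cmod (p $ 1))\<^sup>2" and "y = 1 - (cmod (p $ 2 * E (p $ 1)))\<^sup>2"
  have E: "E holomorphic_on ball 0 1" unfolding E_def by (intro holomorphic_intros h)
  have x: "x > 0" and y: "y > 0"
    using p by (auto simp: hartogs_def E_def x_def y_def abs_square_less_1)
  have cx: "1 - p $ 1 * cnj (p $ 1) = of_real x"
    and cy: "1 - p $ 2 * E (p $ 1) * cnj (p $ 2 * E (p $ 1)) = of_real y"
    by (simp_all only: x_def y_def complex_norm_square of_real_diff of_real_1)
  have EE: "E (p $ 1) * cnj (E (p $ 1)) = of_real (exp (2 * Re (h (p $ 1))))"
    by (simp add: complex_norm_square[symmetric] E_def norm_exp_eq_Re exp_double)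
  have pE: "p \<in> hartogs E" using p by (simp only: E_def)
  have "bergman_kernel (hartogs E) = hartogs_kernel E"
    by (rule bergman_kernel_hartogs[OF E]) (simp add: E_def)
  then have "bergman_kernel (hartogs E) p p =
      E (p $ 1) * cnj (E (p $ 1)) / (of_real (pi\<^sup>2) * (1 - p $ 1 * cnj (p $ 1))\<^sup>2
        * (1 - p $ 2 * E (p $ 1) * cnj (p $ 2 * E (p $ 1)))\<^sup>2)"
    using pE by (simp only: hartogs_kernel_def simp_thms if_True)
  also have "\<dots> = of_real (exp (2 * Re (h (p $ 1))) / (pi\<^sup>2 * x\<^sup>2 * y\<^sup>2))"
    unfolding EE cx cy by simp
  finally have "log_bergman (hartogs E) p = 2 * Re (h (p $ 1)) - (ln (pi\<^sup>2) + 2 * ln x + 2 * ln y)"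
    using x y by (simp add: log_bergman_def ln_div ln_mult ln_realpow)
  then have "complex_of_real (log_bergman (hartogs E) p)
      = of_real (2 * Re (h (p $ 1))) - (of_real (ln (pi\<^sup>2)) + 2 * of_real (ln x) + 2 * of_real (ln y))"
    by (simp only: of_real_diff of_real_add of_real_mult of_real_numeral)
  also have "of_real (2 * Re (h (p $ 1))) = h (p $ 1) + cnj (h (p $ 1))"
    by (rule complex_add_cnj[symmetric])
  also have "complex_of_real (ln x) = Ln (of_real x)"
    using x by (simp add: Ln_of_real)
  also have "complex_of_real (ln y) = Ln (of_real y)"
    using y by (simp add: Ln_of_real)
  finally have "complex_of_real (log_bergman (hartogs E) p) =
    of_real (- ln (pi\<^sup>2)) + h (p $ 1) + cnj (h (p $ 1)) + (- 2) * Ln (of_real x) + (- 2) * Ln (of_real y)"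
    by (simp add: algebra_simps)
  then show ?thesis
    unfolding cx[symmetric] cy[symmetric] by (simp only: E_def)
qed

lemma has_wirtinger_log_bergman_hartogs:
  fixes p :: "complex^2"
  assumes h: "h holomorphic_on ball 0 1" and p: "p \<in> hartogs (\<lambda>z. exp (h z))"
  defines "E \<equiv> exp (h (p $ 1))" and "h' \<equiv> deriv h (p $ 1)"
  defines "u \<equiv> p $ 2 * E"
  shows "has_wirtinger (\<lambda>x. complex_of_real (log_bergman (hartogs (\<lambda>z. exp (h z))) x))
     (h' + 2 * cnj (p $ 1) / (1 - p $ 1 * cnj (p $ 1)) + 2 * (u * cnj u) * h' / (1 - u * cnj u))
     (2 * cnj u * E / (1 - u * cnj u))
     (cnj h' + 2 * (p $ 1) / (1 - p $ 1 * cnj (p $ 1)) + 2 * (u * cnj u) * cnj h' / (1 - u * cnj u))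
     (2 * u * cnj E / (1 - u * cnj u)) p"
proof -
  let ?E = "\<lambda>z. exp (h z)"
  have z: "cmod (p $ 1) < 1" and u: "cmod u < 1"
    using p by (auto simp: hartogs_def u_def E_def)
  have hd: "(h has_field_derivative h') (at (p $ 1))"
    unfolding h'_def using h z by (intro holomorphic_derivI[OF h]) auto
  have pos: "1 - x * cnj x \<notin> \<real>\<^sub>\<le>\<^sub>0" if "cmod x < 1" for x
  proof -
    have "1 - x * cnj x = of_real (1 - (cmod x)\<^sup>2)"
      by (simp add: complex_norm_square[symmetric])
    moreover have "1 - (cmod x)\<^sup>2 > 0"
      using that by (simp add: abs_square_less_1)
    ultimately show ?thesis
      by (metis Re_complex_of_real complex_nonpos_Reals_iff not_le)
  qed
  have Ln: "(Ln has_field_derivative 1 / (1 - x * cnj x)) (at (1 + (- 1) * (x * cnj x)))" if "cmod x < 1" for x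
    using has_field_derivative_Ln[OF pos[OF that]] by (simp add: divide_inverse)
  note nth = has_wirtinger_nth[of p]
  have wh: "has_wirtinger (\<lambda>x. h (x $ 1)) h' 0 0 0 p"
    using has_wirtinger_holomorphic[OF nth(1) hd] by simp
  define U where "U x = x $ 2 * exp (h (x $ 1))" for x :: "complex^2"
  have Up: "U p = u" by (simp add: U_def u_def E_def)
  have wU: "has_wirtinger U (u * h') E 0 0 p"
    unfolding U_def using has_wirtinger_mult[OF nth(2) has_wirtinger_holomorphic[OF wh DERIV_exp]]
    by (simp add: u_def E_def mult.assoc)
  have wL: "has_wirtinger (\<lambda>x. Ln (1 + (- 1) * (f x * cnj (f x))))
      (- a * cnj (f p) / (1 - f p * cnj (f p))) (- b * cnj (f p) / (1 - f p * cnj (f p)))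
      (- f p * cnj a / (1 - f p * cnj (f p))) (- f p * cnj b / (1 - f p * cnj (f p))) p"
    if f: "has_wirtinger f a b 0 0 p" "cmod (f p) < 1" for f a b
    using has_wirtinger_holomorphic[OF has_wirtinger_add[OF has_wirtinger_const[of 1]
          has_wirtinger_mult[OF has_wirtinger_const[of "-1"] has_wirtinger_mult[OF f(1) has_wirtinger_cnj[OF f(1)]]]]
        Ln[OF f(2)]]
    by simp
  have "cmod (U p) < 1" using u Up by simp
  from has_wirtinger_add[OF has_wirtinger_add[OF has_wirtinger_add[OF has_wirtinger_add[OF
       has_wirtinger_const[of "of_real (- ln (pi\<^sup>2))"] wh] has_wirtinger_cnj[OF wh]]
       has_wirtinger_mult[OF has_wirtinger_const[of "-2"] wL[OF nth(1) z]]]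
       has_wirtinger_mult[OF has_wirtinger_const[of "-2"] wL[OF wU this]]]
  have "has_wirtinger (\<lambda>p. of_real (- ln (pi\<^sup>2)) + h (p $ 1) + cnj (h (p $ 1))
        + (- 2) * Ln (1 + (- 1) * (p $ 1 * cnj (p $ 1))) + (- 2) * Ln (1 + (- 1) * (U p * cnj (U p))))
     (h' + 2 * cnj (p $ 1) / (1 - p $ 1 * cnj (p $ 1)) + 2 * (u * cnj u) * h' / (1 - u * cnj u))
     (2 * cnj u * E / (1 - u * cnj u))
     (cnj h' + 2 * (p $ 1) / (1 - p $ 1 * cnj (p $ 1)) + 2 * (u * cnj u) * cnj h' / (1 - u * cnj u))
     (2 * u * cnj E / (1 - u * cnj u)) p"
    by (simp add: Up mult_ac)
  then show ?thesis
    by (rule has_wirtinger_transform[OF _ open_hartogs p])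
      (auto intro!: holomorphic_intros h simp: log_bergman_hartogs[OF h] U_def)
qed

text \<open>The \<open>\<partial>/\<partial>z\<^sub>j\<close>-bar derivatives of \<open>log
  B\<close> are known on all of \<open>\<Omega>\<close> (\<open>G1\<close> and \<open>G2\<close>
  below). The fibre coordinate \<open>U\<close> vanishes along \<open>w = 0\<close>, and
  \<open>U cnj U\<close> vanishes there to second order, so the mixed entries are
  \<open>0\<close>. The conjugate of \<open>h'\<close> is antiholomorphic and disappears under
  \<open>\<partial>/\<partial>z\<^sub>1\<close>; what remains in the first entry is the Bergman
  metric of the unit disk.\<close>

lemma bergman_metric_hartogs_centre:
  fixes z :: complex
  assumes h: "h holomorphic_on ball 0 1" and z: "cmod z < 1"
  shows "bergman_metric (hartogs (\<lambda>z. exp (h z))) (pt z 0) v w =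
    of_real (2 / (1 - (cmod z)\<^sup>2)\<^sup>2) * v $ 1 * cnj (w $ 1) +
    of_real (2 * (cmod (exp (h z)))\<^sup>2) * v $ 2 * cnj (w $ 2)"
proof -
  let ?E = "\<lambda>z. exp (h z)"
  let ?\<Omega> = "hartogs ?E"
  let ?L = "\<lambda>x. complex_of_real (log_bergman ?\<Omega> x)"
  define p where "p = pt z 0"
  have p: "p \<in> ?\<Omega>" and [simp]: "p $ 1 = z" "p $ 2 = 0"
    using z by (simp_all add: p_def pt_in_hartogs)
  have \<Omega>: "open ?\<Omega>" by (intro open_hartogs holomorphic_intros h)
  have zb: "z \<in> ball 0 1" using z by simp
  define h2 where "h2 = deriv (deriv h) z"
  have hd: "(h has_field_derivative deriv h z) (at z)"
    by (rule holomorphic_derivI[OF h _ zb]) simp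
  have hd2: "(deriv h has_field_derivative h2) (at z)"
    unfolding h2_def by (rule holomorphic_derivI[OF holomorphic_deriv[OF h] _ zb]) simp_all
  have zz: "1 - z * cnj z = of_real (1 - (cmod z)\<^sup>2)"
    by (simp add: complex_norm_square[symmetric])
  have zpos: "1 - (cmod z)\<^sup>2 > 0"
    using z by (simp add: abs_square_less_1)
  then have zne: "1 - z * cnj z \<noteq> 0"
    unfolding zz by (metis of_real_eq_0_iff less_irrefl)
  have inv: "((\<lambda>x. 1 / x) has_field_derivative - 1 / x\<^sup>2) (at x)" if "x \<noteq> 0" for x :: complex
    using that by (auto intro!: derivative_eq_intros simp: power2_eq_square)
  note nth = has_wirtinger_nth[of p]
  define U where "U x = x $ 2 * exp (h (x $ 1))" for x :: "complex^2"
  define Q where "Q x = U x * cnj (U x)" for x :: "complex^2"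
  have wE: "has_wirtinger (\<lambda>x. exp (h (x $ 1))) (exp (h z) * deriv h z) 0 0 0 p"
    using has_wirtinger_holomorphic[OF nth(1), of "\<lambda>z. exp (h z)" "exp (h z) * deriv h z"] hd
    by (auto intro!: derivative_eq_intros)
  have wU: "has_wirtinger U 0 (exp (h z)) 0 0 p"
    unfolding U_def using has_wirtinger_mult[OF nth(2) wE] by simp
  have [simp]: "U p = 0" "Q p = 0" by (simp_all add: U_def Q_def)
  have wQ: "has_wirtinger Q 0 0 0 0 p"
    unfolding Q_def using has_wirtinger_mult[OF wU has_wirtinger_cnj[OF wU]] by simp
  have w1Q: "has_wirtinger (\<lambda>x. 1 / (1 + (- 1) * Q x)) 0 0 0 0 p"
    using has_wirtinger_holomorphic[OF has_wirtinger_add[OF has_wirtinger_const[of 1]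
          has_wirtinger_mult[OF has_wirtinger_const[of "-1"] wQ]] inv]
    by simp
  have wh': "has_wirtinger (\<lambda>x. cnj (deriv h (x $ 1))) 0 0 (cnj h2) 0 p"
    using has_wirtinger_cnj[OF has_wirtinger_holomorphic[OF nth(1), of "deriv h" h2]] hd2 by simp
  have wz: "has_wirtinger (\<lambda>x. 1 / (1 + (- 1) * (x $ 1 * cnj (x $ 1))))
      (cnj z / (1 - z * cnj z)\<^sup>2) 0 (z / (1 - z * cnj z)\<^sup>2) 0 p"
    using has_wirtinger_holomorphic[OF has_wirtinger_add[OF has_wirtinger_const[of 1]
          has_wirtinger_mult[OF has_wirtinger_const[of "-1"] has_wirtinger_mult[OF nth(1) has_wirtinger_cnj[OF nth(1)]]]] inv] zne
    by simp
  define G1 where "G1 x = cnj (deriv h (x $ 1)) + 2 * (x $ 1 * (1 / (1 + (- 1) * (x $ 1 * cnj (x $ 1)))))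
     + Q x * (2 * (cnj (deriv h (x $ 1)) * (1 / (1 + (- 1) * Q x))))" for x :: "complex^2"
  define G2 where "G2 x = U x * (2 * (cnj (exp (h (x $ 1))) * (1 / (1 + (- 1) * Q x))))" for x :: "complex^2"
  have wG1: "has_wirtinger G1 (2 / (1 - z * cnj z) + 2 * (z * cnj z) / (1 - z * cnj z)\<^sup>2) 0
      (cnj h2 + 2 * z\<^sup>2 / (1 - z * cnj z)\<^sup>2) 0 p"
    unfolding G1_def
    using has_wirtinger_add[OF has_wirtinger_add[OF wh'
      has_wirtinger_mult[OF has_wirtinger_const[of 2] has_wirtinger_mult[OF nth(1) wz]]]
      has_wirtinger_mult[OF wQ has_wirtinger_mult[OF has_wirtinger_const[of 2] has_wirtinger_mult[OF wh' w1Q]]]]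
    by (simp add: power2_eq_square algebra_simps)
  have wG2: "has_wirtinger G2 0 (2 * (exp (h z) * cnj (exp (h z)))) 0 0 p"
    unfolding G2_def
    using has_wirtinger_mult[OF wU has_wirtinger_mult[OF has_wirtinger_const[of 2]
          has_wirtinger_mult[OF has_wirtinger_cnj[OF wE] w1Q]]]
    by (simp add: mult_ac)
  have "dzbar 1 ?L x = G1 x" "dzbar 2 ?L x = G2 x" if "x \<in> ?\<Omega>" for x
    using has_wirtinger_imp_dz[OF has_wirtinger_log_bergman_hartogs[OF h that]]
    by (simp_all add: G1_def G2_def Q_def U_def mult_ac)
  then have w1: "has_wirtinger (dzbar 1 ?L) (2 / (1 - z * cnj z) + 2 * (z * cnj z) / (1 - z * cnj z)\<^sup>2) 0
      (cnj h2 + 2 * z\<^sup>2 / (1 - z * cnj z)\<^sup>2) 0 p"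
    and w2: "has_wirtinger (dzbar 2 ?L) 0 (2 * (exp (h z) * cnj (exp (h z)))) 0 0 p"
    by (auto intro: has_wirtinger_transform[OF wG1 \<Omega> p] has_wirtinger_transform[OF wG2 \<Omega> p])
  have "2 / (1 - z * cnj z) + 2 * (z * cnj z) / (1 - z * cnj z)\<^sup>2 = 2 / (1 - z * cnj z)\<^sup>2"
    using zne by (simp add: divide_simps power2_eq_square)
  also have "\<dots> = of_real (2 / (1 - (cmod z)\<^sup>2)\<^sup>2)"
    by (simp add: zz)
  finally have g11: "2 / (1 - z * cnj z) + 2 * (z * cnj z) / (1 - z * cnj z)\<^sup>2 = of_real (2 / (1 - (cmod z)\<^sup>2)\<^sup>2)" .
  have g22: "2 * (exp (h z) * cnj (exp (h z))) = of_real (2 * (cmod (exp (h z)))\<^sup>2)"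
    by (simp only: complex_norm_square of_real_mult of_real_numeral)
  show ?thesis
    unfolding bergman_metric_def p_def[symmetric] sum_2
    by (simp only: has_wirtinger_imp_dz[OF w1] has_wirtinger_imp_dz[OF w2] g11 g22) simp
qed

lemma del_log_bergman_hartogs_centre:
  assumes h: "h holomorphic_on ball 0 1" and z: "cmod z < 1"
  shows "del (log_bergman (hartogs (\<lambda>z. exp (h z)))) (pt z 0) X =
    (deriv h z + 2 * cnj z / (1 - z * cnj z)) * X $ 1"
proof -
  have "pt z 0 \<in> hartogs (\<lambda>z. exp (h z))" using z by (simp add: pt_in_hartogs)
  from has_wirtinger_imp_dz[OF has_wirtinger_log_bergman_hartogs[OF h this]]
  show ?thesis
    unfolding del_def sum_2 by simp
qed

text \<open>The vector \<open>((1 - \<bar>z\<bar>\<^sup>2) / 2, 0)\<close> has length less than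
  \<open>1\<close>. The supremum is at least the value at this vector because it is taken over a
  bounded set of reals: the metric controls the first component of \<open>X\<close>, and
  \<open>\<partial> log B\<close> at \<open>(z, 0)\<close> depends on no other.\<close>

lemma del_norm_hartogs_centre_lower:
  assumes h: "h holomorphic_on ball 0 1" and z: "cmod z < 1"
  shows "(1 - (cmod z)\<^sup>2) / 2 * cmod (deriv h z + 2 * cnj z / (1 - z * cnj z))
    \<le> del_norm (hartogs (\<lambda>z. exp (h z))) (log_bergman (hartogs (\<lambda>z. exp (h z)))) (pt z 0)"
proof -
  let ?\<Omega> = "hartogs (\<lambda>z. exp (h z))"
  define s where "s = 1 - (cmod z)\<^sup>2"
  define D where "D = deriv h z + 2 * cnj z / (1 - z * cnj z)"
  define A where "A = {X. Re (bergman_metric ?\<Omega> (pt z 0) X X) \<le> 1}"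
  have s: "0 < s" using z by (simp add: s_def abs_square_less_1)
  have g: "Re (bergman_metric ?\<Omega> (pt z 0) X X)
      = 2 / s\<^sup>2 * (cmod (X $ 1))\<^sup>2 + 2 * (cmod (exp (h z)))\<^sup>2 * (cmod (X $ 2))\<^sup>2" for X
  proof -
    have "bergman_metric ?\<Omega> (pt z 0) X X
      = of_real (2 / s\<^sup>2 * (cmod (X $ 1))\<^sup>2 + 2 * (cmod (exp (h z)))\<^sup>2 * (cmod (X $ 2))\<^sup>2)"
      unfolding bergman_metric_hartogs_centre[OF h z] s_def[symmetric]
      by (simp only: of_real_add of_real_mult complex_norm_square mult.assoc)
    then show ?thesis by simp
  qed
  have del: "cmod (del (log_bergman ?\<Omega>) (pt z 0) X) = cmod D * cmod (X $ 1)" for X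
    by (simp add: del_log_bergman_hartogs_centre[OF h z] D_def norm_mult)
  have bdd: "bdd_above ((\<lambda>X. cmod (del (log_bergman ?\<Omega>) (pt z 0) X)) ` A)"
  proof (rule bdd_aboveI2)
    fix X assume "X \<in> A"
    moreover have "0 \<le> 2 * (cmod (exp (h z)))\<^sup>2 * (cmod (X $ 2))\<^sup>2" by simp
    ultimately have "2 / s\<^sup>2 * (cmod (X $ 1))\<^sup>2 \<le> 1"
      unfolding A_def mem_Collect_eq g by linarith
    then have "2 * (cmod (X $ 1))\<^sup>2 \<le> s\<^sup>2"
      using s by (simp add: divide_simps)
    then have "(cmod (X $ 1))\<^sup>2 \<le> s\<^sup>2"
      using zero_le_power2[of "cmod (X $ 1)"] by linarith
    then have "cmod (X $ 1) \<le> s"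
      using s by (simp add: power2_le_iff_abs_le)
    then show "cmod (del (log_bergman ?\<Omega>) (pt z 0) X) \<le> cmod D * s"
      unfolding del by (intro mult_left_mono) auto
  qed
  have "pt (of_real (s / 2)) 0 \<in> A"
    using s unfolding A_def mem_Collect_eq g by (simp add: power_divide)
  from cSUP_upper[OF this bdd] show ?thesis
    using s unfolding del_norm_def A_def[symmetric] del by (simp add: s_def[symmetric] D_def mult.commute)
qed

section \<open>Hartogs domains over the disk and the bidisk\<close>

lemma biholomorphic_hartogs_bidisk:
  assumes E: "E holomorphic_on ball 0 1" and nz: "\<And>z. cmod z < 1 \<Longrightarrow> E z \<noteq> 0"
  shows "biholomorphic_Cn (hartogs E) bidisk"
proof -
  define F where "F p = pt (p $ 1) (p $ 2 * E (p $ 1))" for p :: "complex^2"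
  define G where "G x = pt (x $ 1) (x $ 2 * (1 / E (x $ 1)))" for x :: "complex^2"
  have F: "holo_map_on (hartogs E) F"
    unfolding holo_map_on_def forall_2 F_def pt_nth
    by (intro conjI holo_fun_on_nth holo_fun_on_hartogs_fibre_coord E)
  have iE: "(\<lambda>z. 1 / E z) holomorphic_on ball 0 1"
    by (intro holomorphic_intros E) (use nz in auto)
  have G: "holo_map_on bidisk G"
    unfolding holo_map_on_def forall_2 G_def pt_nth
    by (intro conjI holo_fun_on_nth holo_fun_on_mult holo_fun_on_compose[OF holo_fun_on_nth iE])
      (auto simp: bidisk_def)
  have cont: "continuous_on S H" if "holo_map_on S H" for S and H :: "complex^2 \<Rightarrow> complex^2"
    using that unfolding holo_map_on_def
    using continuous_on_vec_lambda[of S "\<lambda>i x. H x $ i"]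
    by (simp add: holo_fun_on_imp_continuous_on)
  have "homeomorphism (hartogs E) bidisk F G"
  proof (rule homeomorphismI)
    show "continuous_on (hartogs E) F" "continuous_on bidisk G"
      using F G by (auto intro: cont)
    show "F ` hartogs E \<subseteq> bidisk"
      by (auto simp: F_def hartogs_def bidisk_def)
    show "G ` bidisk \<subseteq> hartogs E"
      using nz by (auto simp: G_def hartogs_def bidisk_def)
    show "G (F p) = p" if "p \<in> hartogs E" for p
      using that nz pt_eta[of p] by (simp add: F_def G_def hartogs_def)
    show "F (G x) = x" if "x \<in> bidisk" for x
      using that nz pt_eta[of x] by (simp add: F_def G_def bidisk_def)
  qed
  with F G show ?thesis
    unfolding biholomorphic_Cn_def by blast
qed

lemma connected_bidisk: "connected bidisk"
proof -
  have eq: "bidisk = (\<lambda>(z, w). pt z w) ` (ball 0 1 \<times> ball 0 1)"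
  proof (intro equalityI subsetI)
    fix p assume "p \<in> bidisk"
    then show "p \<in> (\<lambda>(z, w). pt z w) ` (ball 0 1 \<times> ball 0 1)"
      by (intro image_eqI[of _ _ "(p $ 1, p $ 2)"]) (auto simp: bidisk_def pt_eta)
  qed (auto simp: bidisk_def)
  show ?thesis
    unfolding eq by (intro connected_continuous_image connected_Times connected_ball
        linear_continuous_on bounded_linear_pt)
qed

lemma domain_hartogs:
  assumes E: "E holomorphic_on ball 0 1" and nz: "\<And>z. cmod z < 1 \<Longrightarrow> E z \<noteq> 0"
  shows "domain_Cn (hartogs E)"
proof -
  obtain F G where "homeomorphism (hartogs E) bidisk F G"
    using biholomorphic_hartogs_bidisk[OF E nz] by (auto simp: biholomorphic_Cn_def)
  then have "connected (hartogs E)"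
    using connected_bidisk by (metis connected_continuous_image homeomorphism_def)
  moreover have "pt 0 0 \<in> hartogs E"
    by (simp add: pt_in_hartogs)
  ultimately show ?thesis
    using open_hartogs[OF E] by (auto simp: domain_Cn_def)
qed

lemma bounded_hartogs:
  assumes "\<And>z. cmod z < 1 \<Longrightarrow> 1 \<le> cmod (E z)"
  shows "bounded (hartogs E)"
proof (rule boundedI)
  fix p assume p: "p \<in> hartogs E"
  then have z: "cmod (p $ 1) < 1" and w: "cmod (p $ 2) * cmod (E (p $ 1)) < 1"
    by (auto simp: hartogs_def norm_mult)
  have "cmod (p $ 2) * 1 \<le> cmod (p $ 2) * cmod (E (p $ 1))"
    using assms[OF z] by (intro mult_left_mono) auto
  moreover have "norm p \<le> cmod (p $ 1) + cmod (p $ 2)"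
    using L2_set_le_sum[of UNIV "\<lambda>i. cmod (p $ i)"] by (simp add: norm_vec_def sum_2)
  ultimately show "norm p \<le> 2" using z w by linarith
qed

section \<open>The example\<close>

theorem proposition1p11:
  shows "\<exists>\<Omega> :: (complex^2) set. domain_Cn \<Omega> \<and> bounded \<Omega> \<and> biholomorphic_Cn \<Omega> bidisk \<and>
           \<not> bounded ((\<lambda>z. del_norm \<Omega> (log_bergman \<Omega>) z) ` \<Omega>)"
proof -
  define h where "h z = 1 / (1 - z)" for z :: complex
  let ?E = "\<lambda>z. exp (h z)"
  let ?\<Omega> = "hartogs ?E"
  have ne: "1 - z \<noteq> 0" if "cmod z < 1" for z :: complex
    using that by auto
  have h: "h holomorphic_on ball 0 1"
    unfolding h_def by (intro holomorphic_intros) (use ne in auto)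
  have E: "?E holomorphic_on ball 0 1"
    by (intro holomorphic_intros h)
  have E1: "1 \<le> cmod (?E z)" if "cmod z < 1" for z
  proof -
    have "Re z < 1" using that complex_Re_le_cmod[of z] by linarith
    then have "0 \<le> Re (h z)" by (simp add: h_def Re_divide)
    then show ?thesis by (simp add: norm_exp_eq_Re)
  qed
  have unbounded: "\<not> bounded ((\<lambda>z. del_norm ?\<Omega> (log_bergman ?\<Omega>) z) ` ?\<Omega>)"
  proof
    assume "bounded ((\<lambda>z. del_norm ?\<Omega> (log_bergman ?\<Omega>) z) ` ?\<Omega>)"
    then obtain B where "B > 0" and B: "\<And>p. p \<in> ?\<Omega> \<Longrightarrow> \<bar>del_norm ?\<Omega> (log_bergman ?\<Omega>) p\<bar> \<le> B"
      unfolding bounded_pos by auto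
    (* With this r the lower bound at (r, 0) is (1 + r) (B + 1) + r, which exceeds B. *)
    define r where "r = 1 - 1 / (2 * B + 2)"
    have r: "0 < r" "r < 1"
      using \<open>B > 0\<close> by (auto simp: r_def field_simps)
    have rc: "cmod (of_real r) < 1" using r by simp
    have "(h has_field_derivative 1 / (1 - of_real r)\<^sup>2) (at (of_real r))"
      unfolding h_def using ne[OF rc] by (auto intro!: derivative_eq_intros simp: power2_eq_square)
    then have d: "deriv h (of_real r) = of_real (1 / (1 - r)\<^sup>2)"
      by (simp add: DERIV_imp_deriv)
    have "(1 - r\<^sup>2) / 2 * (1 / (1 - r)\<^sup>2 + 2 * r / (1 - r * r)) \<le> B"
    proof -
      have "deriv h (of_real r) + 2 * cnj (of_real r) / (1 - of_real r * cnj (of_real r))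
        = of_real (1 / (1 - r)\<^sup>2 + 2 * r / (1 - r * r))"
        unfolding d by simp
      moreover have "0 \<le> 1 / (1 - r)\<^sup>2 + 2 * r / (1 - r * r)"
        using r mult_strict_mono[of r 1 r 1] by auto
      ultimately have "cmod (deriv h (of_real r) + 2 * cnj (of_real r) / (1 - of_real r * cnj (of_real r)))
        = 1 / (1 - r)\<^sup>2 + 2 * r / (1 - r * r)"
        by (simp only: norm_of_real abs_of_nonneg)
      moreover have "pt (of_real r) 0 \<in> ?\<Omega>" using rc by (simp add: pt_in_hartogs)
      ultimately show ?thesis
        using del_norm_hartogs_centre_lower[OF h rc] B[of "pt (of_real r) 0"] r by simp
    qed
    moreover have "(1 - r\<^sup>2) / 2 * (1 / (1 - r)\<^sup>2 + 2 * r / (1 - r * r)) = (1 + r) / (2 * (1 - r)) + r"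
    proof -
      have "1 - r \<noteq> 0" "1 + r \<noteq> 0" "1 - r\<^sup>2 = (1 - r) * (1 + r)" "1 - r * r = (1 - r) * (1 + r)"
        using r by (auto simp: algebra_simps power2_eq_square)
      then show ?thesis by (simp add: power2_eq_square divide_simps)
    qed
    moreover have "(1 + r) / (2 * (1 - r)) = (1 + r) * (B + 1)"
      using \<open>B > 0\<close> by (simp add: r_def field_simps)
    moreover have "(1 + r) * (B + 1) \<ge> B + 1"
      using r \<open>B > 0\<close> by (simp add: algebra_simps)
    ultimately show False using r by linarith
  qed
  show ?thesis
    by (intro exI[of _ ?\<Omega>] conjI unbounded domain_hartogs bounded_hartogs
        biholomorphic_hartogs_bidisk E E1) simp_all
qed

end
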